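(* Consider the $(1,\lambda)$-CSA-ES with $\lambda\ge2$, $0<c\le1$ and $d_\sigma>0$, applied to $f(x)=[x]_1$ on $\mathbb{R}^n$. Then, almost surely and in expectation (i.e. both $\frac1t\ln(\sigma_t/\sigma_0)$ almost surely and $\frac1t\mathbb{E}(\ln(\sigma_t/\sigma_0))$), $$\frac1t\ln\Big(\frac{\sigma_t}{\sigma_0}\Big)\xrightarrow[t\to\infty]{}\frac{1}{2d_\sigma n}\Big(2(1-c)\,\mathbb{E}(\mathcal{N}_{1:\lambda})^2+c\big(\mathbb{E}(\mathcal{N}_{1:\lambda}^2)-1\big)\Big),$$ and this limit is strictly positive for $\lambda\ge3$, and for $\lambda=2$ when $c<1$; thus the step-size diverges geometrically fast if $c<1$ or $\lambda\ge3$.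
   Context: For $x\in\mathbb{R}^n$, $[x]_i$ denotes its $i$-th coordinate. The $(1,\lambda)$-CSA-ES with parameters $\lambda\ge1$, $0<c\le1$, $d_\sigma>0$, minimizing $f:\mathbb{R}^n\to\mathbb{R}$, is defined as follows. Start from $X_0\in\mathbb{R}^n$, $\sigma_0>0$, and $p_0\sim\mathcal{N}(0,I_n)$. At iteration $t$, draw $\xi_{t,1},\ldots,\xi_{t,\lambda}$ i.i.d. $\sim\mathcal{N}(0,I_n)$, independent of everything before; the children are $Y_{t,i}=X_t+\sigma_t\xi_{t,i}$. The next parent $X_{t+1}$ is the child with the smallest $f$-value, and $\xi^\star_t$ denotes the corresponding $\xi_{t,i}$, so that $X_{t+1}=X_t+\sigma_t\xi^\star_t$. The cumulative path is $p_{t+1}=(1-c)p_t+\sqrt{c(2-c)}\,\xi^\star_t$, and the step-size is updated as $\sigma_{t+1}=\sigma_t\exp\!\big(\tfrac{c}{2d_\sigma}(\|p_{t+1}\|^2/n-1)\big)$. For i.i.d. standard normal $\mathcal{N}_1,\ldots,\mathcal{N}_\lambda$, $\mathcal{N}_{1:\lambda}$ denotes their minimum; $\mathbb{E}(\mathcal{N}_{1:\lambda})^2$ is the square of the expectation. *)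

theory Defs
  imports "HOL-Probability.Probability"
begin

(* Vectors of R^n are represented as functions nat => real; only the coordinates
   j < n are meaningful.  Coordinate 0 represents [x]_1. *)

definition sqnorm :: "nat \<Rightarrow> (nat \<Rightarrow> real) \<Rightarrow> real" where
  "sqnorm n x = (\<Sum>j<n. (x j)\<^sup>2)"

(* index of the selected child among Y_i = X + sigma * xi_i, i < lam:
   one with smallest f-value (ties, a null event, broken by smallest index) *)
definition csa_select ::
  "nat \<Rightarrow> ((nat \<Rightarrow> real) \<Rightarrow> real) \<Rightarrow> (nat \<Rightarrow> real) \<Rightarrow> real \<Rightarrow> (nat \<Rightarrow> nat \<Rightarrow> real) \<Rightarrow> nat" where
  "csa_select lam f X \<sigma> xs =
     (LEAST i. i < lam \<and> (\<forall>k<lam. f (\<lambda>j. X j + \<sigma> * xs i j) \<le> f (\<lambda>j. X j + \<sigma> * xs k j)))"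

(* state (X_t, sigma_t, p_t) of the (1,lambda)-CSA-ES; xi t i j = [xi_{t,i}]_{j+1} *)
primrec csa_state ::
  "nat \<Rightarrow> nat \<Rightarrow> real \<Rightarrow> real \<Rightarrow> ((nat \<Rightarrow> real) \<Rightarrow> real) \<Rightarrow>
   (nat \<Rightarrow> real) \<Rightarrow> real \<Rightarrow> (nat \<Rightarrow> real) \<Rightarrow> (nat \<Rightarrow> nat \<Rightarrow> nat \<Rightarrow> real) \<Rightarrow> nat \<Rightarrow>
   (nat \<Rightarrow> real) \<times> real \<times> (nat \<Rightarrow> real)" where
  "csa_state n lam c d_\<sigma> f X0 \<sigma>0 p0 xi 0 = (X0, \<sigma>0, p0)"
| "csa_state n lam c d_\<sigma> f X0 \<sigma>0 p0 xi (Suc t) =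
     (case csa_state n lam c d_\<sigma> f X0 \<sigma>0 p0 xi t of (X, \<sigma>, p) \<Rightarrow>
       (let i = csa_select lam f X \<sigma> (xi t);
            xs = xi t i;
            p' = (\<lambda>j. (1 - c) * p j + sqrt (c * (2 - c)) * xs j)
        in ((\<lambda>j. X j + \<sigma> * xs j), \<sigma> * exp (c / (2 * d_\<sigma>) * (sqnorm n p' / real n - 1)), p')))"

definition csa_sigma where
  "csa_sigma n lam c d_\<sigma> f X0 \<sigma>0 p0 xi t = fst (snd (csa_state n lam c d_\<sigma> f X0 \<sigma>0 p0 xi t))"

definition std_normal_vec :: "nat \<Rightarrow> (nat \<Rightarrow> real) measure" where
  "std_normal_vec lam = PiM {..<lam} (\<lambda>_. density lborel std_normal_density)"

definition mean_min_normal :: "nat \<Rightarrow> real" where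
  "mean_min_normal lam = (\<integral>x. Min (x ` {..<lam}) \<partial>std_normal_vec lam)"

definition mean_sq_min_normal :: "nat \<Rightarrow> real" where
  "mean_sq_min_normal lam = (\<integral>x. (Min (x ` {..<lam}))\<^sup>2 \<partial>std_normal_vec lam)"

end

theory Submission
  imports Defs "HOL-Library.Discrete_Functions"
begin

text \<open>On the linear function the selected child is the one whose step has the smallest first
  coordinate, so the selected steps are independent and identically distributed. Each coordinate of
  the path follows \<open>p' = (1 - c) * p + b * x\<close> with \<open>b\<^sup>2 = c * (2 - c)\<close>. Squaring and summing over
  time, the terms \<open>p\<^sup>2\<close> telescope, and the average of \<open>p\<^sup>2\<close> is expressed through the averages
  of \<open>x\<^sup>2\<close>, of \<open>p\<close> and of the martingale differences \<open>p * (x - E x)\<close>; as fourth moments stay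
  bounded, a strong law for orthogonal sequences handles all of these. The limit is
  \<open>2 * (1 - c) * (E x)\<^sup>2 / c + E x\<^sup>2\<close>, where \<open>E x = 0\<close> and \<open>E x\<^sup>2 = 1\<close> for all coordinates but
  the first. Positivity follows from comparing the tail of the squared minimum with that of the
  square of a single normal variable.\<close>

section \<open>A strong law for orthogonal sequences\<close>

text \<open>The path is neither independent over time nor stationary: it starts from a standard
  normal vector, whereas the selected first coordinates have the law of a minimum. A law for i.i.d.
  sequences therefore says nothing about its squares. What survives is orthogonality: the centred
  steps, the centred squared steps and the products of the path with the next centred step are each
  uncorrelated over time. Their second moments involve fourth powers of steps and path, which is why
  fourth moments appear throughout. The limit is what stationarity would force. With m and q the
  first two moments of a step, E p = b * m / c, and (1 - (1 - c)^2) * E p^2 = 2 * (1 - c) * b * m *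
  E p + b^2 * q. As 1 - (1 - c)^2 = c * (2 - c) = b^2, the normalisation cancels. The squared norm
  is a sum over coordinates, so each coordinate is averaged separately. The n - 1 unselected ones
  contribute 1 each, which leaves only the excess of the first coordinate after the -1 of the
  step-size rule. For two children the tail comparison is an equality; positivity then comes from
  the mean of the minimum, hence the condition c < 1.\<close>

context prob_space begin

text \<open>A Borel-Cantelli argument by monotone convergence: the random series of the
  \<open>D k\<close> has finite expectation, so it converges almost everywhere and its terms
  vanish.\<close>

lemma AE_tendsto_0_if_summable_expectation:
  fixes D :: "nat \<Rightarrow> 'a \<Rightarrow> real"
  assumes int: "\<And>k. integrable M (D k)"
    and nonneg: "\<And>k \<omega>. 0 \<le> D k \<omega>"
    and bound: "\<And>k. expectation (D k) \<le> B k" and summ: "summable B"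
  shows "AE \<omega> in M. (\<lambda>k. D k \<omega>) \<longlonglongrightarrow> 0"
proof -
  have [measurable]: "D k \<in> borel_measurable M" for k using int by auto
  have B0: "0 \<le> B k" for k
    by (rule order_trans[OF _ bound]) (simp add: nonneg)
  have "(\<integral>\<^sup>+\<omega>. (\<Sum>k. ennreal (D k \<omega>)) \<partial>M) = (\<Sum>k. ennreal (expectation (D k)))"
    by (simp add: nn_integral_suminf nn_integral_eq_integral[OF int] nonneg)
  also have "\<dots> \<le> (\<Sum>k. ennreal (B k))"
    by (intro suminf_le ennreal_leI bound) auto
  also have "\<dots> = ennreal (\<Sum>k. B k)"
    by (rule suminf_ennreal2[OF B0 summ])
  also have "\<dots> < \<infinity>" by simp
  finally have "AE \<omega> in M. (\<Sum>k. ennreal (D k \<omega>)) \<noteq> \<infinity>"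
    by (intro nn_integral_PInf_AE) auto
  then show ?thesis
  proof eventually_elim
    case (elim \<omega>)
    then have "summable (\<lambda>k. D k \<omega>)" using nonneg by (auto intro: summable_suminf_not_top)
    then show ?case by (rule summable_LIMSEQ_zero)
  qed
qed

text \<open>Only the diagonal terms survive expansion of the square, so the second moment grows
  linearly in the number of terms. An arbitrary finite index set is allowed because the blocks
  between consecutive squares are needed as well as initial segments.\<close>

lemma expectation_square_sum_orthogonal:
  fixes Y :: "nat \<Rightarrow> 'a \<Rightarrow> real"
  assumes int: "\<And>s t. integrable M (\<lambda>\<omega>. Y s \<omega> * Y t \<omega>)"
    and orth: "\<And>s t. s < t \<Longrightarrow> expectation (\<lambda>\<omega>. Y s \<omega> * Y t \<omega>) = 0"
    and bound: "\<And>t. expectation (\<lambda>\<omega>. (Y t \<omega>)\<^sup>2) \<le> C" and "finite A"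
  shows "integrable M (\<lambda>\<omega>. (\<Sum>s\<in>A. Y s \<omega>)\<^sup>2)"
    and "expectation (\<lambda>\<omega>. (\<Sum>s\<in>A. Y s \<omega>)\<^sup>2) \<le> C * card A"
proof -
  have eq: "(\<Sum>s\<in>A. Y s \<omega>)\<^sup>2 = (\<Sum>s\<in>A. \<Sum>t\<in>A. Y s \<omega> * Y t \<omega>)" for \<omega>
    by (simp add: power2_eq_square sum_product)
  show "integrable M (\<lambda>\<omega>. (\<Sum>s\<in>A. Y s \<omega>)\<^sup>2)"
    unfolding eq by (intro Bochner_Integration.integrable_sum int)
  have orth': "expectation (\<lambda>\<omega>. Y s \<omega> * Y t \<omega>) = 0" if "s \<noteq> t" for s t
    using orth[of s t] orth[of t s] that by (cases s t rule: linorder_cases) (auto simp: mult.commute)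
  have "expectation (\<lambda>\<omega>. (\<Sum>s\<in>A. Y s \<omega>)\<^sup>2) = (\<Sum>s\<in>A. \<Sum>t\<in>A. expectation (\<lambda>\<omega>. Y s \<omega> * Y t \<omega>))"
    unfolding eq by (simp add: int)
  also have "\<dots> = (\<Sum>s\<in>A. \<Sum>t\<in>A. if s = t then expectation (\<lambda>\<omega>. (Y s \<omega>)\<^sup>2) else 0)"
    by (intro sum.cong refl) (auto simp: orth' power2_eq_square)
  also have "\<dots> = (\<Sum>s\<in>A. expectation (\<lambda>\<omega>. (Y s \<omega>)\<^sup>2))"
    using \<open>finite A\<close> by simp
  also have "\<dots> \<le> C * card A"
    using sum_mono[of A "\<lambda>s. expectation (\<lambda>\<omega>. (Y s \<omega>)\<^sup>2)" "\<lambda>_. C"] bound by (simp add: mult.commute)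
  finally show "expectation (\<lambda>\<omega>. (\<Sum>s\<in>A. Y s \<omega>)\<^sup>2) \<le> C * card A" .
qed

text \<open>Along the squares \<open>t = k\<^sup>2\<close> the second moments of the averages are summable, and between
  consecutive squares the sum moves so little that the union bound over all \<open>2 * k + 1\<close> increments
  suffices.\<close>
lemma strong_law_orthogonal:
  fixes Y :: "nat \<Rightarrow> 'a \<Rightarrow> real"
  assumes int: "\<And>s t. integrable M (\<lambda>\<omega>. Y s \<omega> * Y t \<omega>)"
    and orth: "\<And>s t. s < t \<Longrightarrow> expectation (\<lambda>\<omega>. Y s \<omega> * Y t \<omega>) = 0"
    and bound: "\<And>t. expectation (\<lambda>\<omega>. (Y t \<omega>)\<^sup>2) \<le> C"
  shows "AE \<omega> in M. (\<lambda>t. (\<Sum>s<t. Y s \<omega>) / real t) \<longlonglongrightarrow> 0"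
proof -
  define T where "T a b \<omega> = (\<Sum>s\<in>{a..<b}. Y s \<omega>)" for a b :: nat and \<omega>
  have Tint: "integrable M (\<lambda>\<omega>. (T a b \<omega>)\<^sup>2)" for a b
    unfolding T_def by (rule expectation_square_sum_orthogonal(1)[OF int orth bound]) auto
  have Tle: "expectation (\<lambda>\<omega>. (T a b \<omega>)\<^sup>2) \<le> C * real (b - a)" for a b
    unfolding T_def 
    using expectation_square_sum_orthogonal(2)[OF int orth bound, where A = "{a..<b}"] by simp
  have C0: "0 \<le> C"
    using bound[of 0] by (rule order_trans[rotated]) simp
  \<comment> \<open>One quantity dominates the squared average at time k^2 and every squared partial
    sum inside the block that follows. The divisor k^4 is the square of the length k^2. The block
    has 2 * k + 1 terms, each with expectation at most C * (2 * k + 1), so the expectation of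
    \<open>D k\<close> is of order 1 / k^2.\<close>
  define D where "D k \<omega> =
    ((T 0 (k\<^sup>2) \<omega>)\<^sup>2 + (\<Sum>t\<in>{k\<^sup>2..<(Suc k)\<^sup>2}. (T (k\<^sup>2) t \<omega>)\<^sup>2)) / real k ^ 4" for k \<omega>
  have "AE \<omega> in M. (\<lambda>k. D k \<omega>) \<longlonglongrightarrow> 0"
  proof (rule AE_tendsto_0_if_summable_expectation)
    show "integrable M (D k)" for k
      unfolding D_def by (intro integrable_divide Bochner_Integration.integrable_add Bochner_Integration.integrable_sum Tint)
    show "0 \<le> D k \<omega>" for k \<omega>
      unfolding D_def by (intro divide_nonneg_nonneg add_nonneg_nonneg sum_nonneg) auto
    show "summable (\<lambda>k. C * 10 * inverse (real k ^ 2))"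
      by (intro summable_mult inverse_power_summable) auto
    fix k
    have "expectation (D k) = (expectation (\<lambda>\<omega>. (T 0 (k\<^sup>2) \<omega>)\<^sup>2) +
       (\<Sum>t\<in>{k\<^sup>2..<(Suc k)\<^sup>2}. expectation (\<lambda>\<omega>. (T (k\<^sup>2) t \<omega>)\<^sup>2))) / real k ^ 4"
      unfolding D_def by (simp add: Tint)
    also have "\<dots> \<le> (C * real (k\<^sup>2) + (\<Sum>t\<in>{k\<^sup>2..<(Suc k)\<^sup>2}. C * (2 * real k + 1))) / real k ^ 4"
    proof (intro divide_right_mono add_mono sum_mono)
      show "expectation (\<lambda>\<omega>. (T 0 (k\<^sup>2) \<omega>)\<^sup>2) \<le> C * real (k\<^sup>2)" using Tle[of 0 "k\<^sup>2"] by simp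
      fix t assume "t \<in> {k\<^sup>2..<(Suc k)\<^sup>2}"
      then have "t - k\<^sup>2 \<le> 2 * k + 1" by (auto simp: power2_eq_square)
      then have "real (t - k\<^sup>2) \<le> 2 * real k + 1" by linarith
      then show "expectation (\<lambda>\<omega>. (T (k\<^sup>2) t \<omega>)\<^sup>2) \<le> C * (2 * real k + 1)"
        using Tle[of "k\<^sup>2" t] C0 by (meson mult_left_mono order_trans)
    qed simp
    also have "\<dots> = C * ((real k)\<^sup>2 + (2 * real k + 1)\<^sup>2) / real k ^ 4"
    proof -
      have "(Suc k)\<^sup>2 - k\<^sup>2 = 2 * k + 1" by (simp add: power2_eq_square)
      then show ?thesis by (simp add: algebra_simps power2_eq_square)
    qed
    \<comment> \<open>The bracket is 5 * k^2 + 4 * k + 1, at most 10 * k^2 once k is at least 1. For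
      k = 0 both sides are 0, since division by 0 yields 0.\<close>
    also have "\<dots> \<le> C * 10 * inverse (real k ^ 2)"
    proof (cases "k = 0")
      case False
      have "1 \<le> real k" using False by simp
      have "real k \<le> (real k)\<^sup>2" using \<open>1 \<le> real k\<close> by (simp add: power2_eq_square)
      moreover have "(2 * real k + 1)\<^sup>2 = 4 * (real k)\<^sup>2 + 4 * real k + 1"
        by (simp add: power2_eq_square algebra_simps)
      ultimately have "(real k)\<^sup>2 + (2 * real k + 1)\<^sup>2 \<le> 10 * (real k)\<^sup>2"
        using \<open>1 \<le> real k\<close> by linarith
      then have "C * ((real k)\<^sup>2 + (2 * real k + 1)\<^sup>2) / real k ^ 4 \<le> C * (10 * (real k)\<^sup>2) / real k ^ 4"
        using C0 by (intro divide_right_mono mult_left_mono) auto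
      also have "\<dots> = C * 10 * inverse (real k ^ 2)"
        using False by (simp add: field_simps power2_eq_square power4_eq_xxxx)
      finally show ?thesis .
    qed simp
    finally show "expectation (D k) \<le> C * 10 * inverse (real k ^ 2)" .
  qed
  then show ?thesis
  proof eventually_elim
    case (elim \<omega>)
    define S where "S t = (\<Sum>s<t. Y s \<omega>)" for t
    \<comment> \<open>With k the integer square root of t, the sum splits at k^2, and each part
      divided by k^2 is at most the root of \<open>D k\<close>. Dividing by t instead only helps,
      because k^2 \<le> t.\<close>
    have key: "\<bar>S t / real t\<bar> \<le> 2 * sqrt (D (floor_sqrt t) \<omega>)" if "0 < t" for t
    proof -
      define k where "k = floor_sqrt t"
      have k: "0 < k" "k\<^sup>2 \<le> t" "t < (Suc k)\<^sup>2"
        using that Suc_floor_sqrt_power2_gt[of t] by (auto simp: k_def)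
      have split: "S t = T 0 (k\<^sup>2) \<omega> + T (k\<^sup>2) t \<omega>"
        using k(2) by (simp add: S_def T_def atLeast0LessThan[symmetric] sum.atLeastLessThan_concat)
      have k4: "sqrt (real k ^ 4) = (real k)\<^sup>2"
        by (rule real_sqrt_unique) (auto simp: power4_eq_xxxx power2_eq_square)
      have part: "\<bar>z\<bar> / (real k)\<^sup>2 \<le> sqrt (D k \<omega>)" if "z\<^sup>2 \<le> D k \<omega> * real k ^ 4" for z
      proof -
        have "\<bar>z\<bar> = sqrt (z\<^sup>2)" by simp
        also have "\<dots> \<le> sqrt (D k \<omega> * real k ^ 4)" using that by (rule real_sqrt_le_mono)
        also have "\<dots> = sqrt (D k \<omega>) * (real k)\<^sup>2" by (simp add: real_sqrt_mult k4)
        finally show ?thesis using k(1) by (simp add: divide_le_eq)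
      qed
      have Dk: "D k \<omega> * real k ^ 4 =
          (T 0 (k\<^sup>2) \<omega>)\<^sup>2 + (\<Sum>t\<in>{k\<^sup>2..<(Suc k)\<^sup>2}. (T (k\<^sup>2) t \<omega>)\<^sup>2)"
        using k(1) by (simp add: D_def)
      have 1: "\<bar>T 0 (k\<^sup>2) \<omega>\<bar> / (real k)\<^sup>2 \<le> sqrt (D k \<omega>)"
        by (rule part) (simp add: Dk sum_nonneg)
      have "(T (k\<^sup>2) t \<omega>)\<^sup>2 \<le> (\<Sum>t\<in>{k\<^sup>2..<(Suc k)\<^sup>2}. (T (k\<^sup>2) t \<omega>)\<^sup>2)"
        using k by (intro member_le_sum) auto
      then have 2: "\<bar>T (k\<^sup>2) t \<omega>\<bar> / (real k)\<^sup>2 \<le> sqrt (D k \<omega>)"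
        by (intro part) (simp add: Dk add_increasing)
      have "\<bar>S t / real t\<bar> \<le> (\<bar>T 0 (k\<^sup>2) \<omega>\<bar> + \<bar>T (k\<^sup>2) t \<omega>\<bar>) / real t"
        unfolding split by (simp add: divide_right_mono)
      also have "\<dots> \<le> (\<bar>T 0 (k\<^sup>2) \<omega>\<bar> + \<bar>T (k\<^sup>2) t \<omega>\<bar>) / (real k)\<^sup>2"
        using k that of_nat_mono[OF k(2), where 'a=real] by (intro divide_left_mono) auto
      also have "\<dots> \<le> 2 * sqrt (D k \<omega>)" using 1 2 by (simp add: add_divide_distrib)
      finally show ?thesis by (simp add: k_def)
    qed
    have fs: "filterlim floor_sqrt at_top at_top"
      unfolding filterlim_at_top
    proof
      fix Z
      show "\<forall>\<^sub>F t in at_top. Z \<le> floor_sqrt t"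
        using eventually_ge_at_top[of "Z\<^sup>2"] by eventually_elim (simp add: le_floor_sqrt_iff)
    qed
    have "(\<lambda>t. 2 * sqrt (D (floor_sqrt t) \<omega>)) \<longlonglongrightarrow> 2 * sqrt 0"
      by (intro tendsto_intros filterlim_compose[OF elim fs])
    then have "(\<lambda>t. 2 * sqrt (D (floor_sqrt t) \<omega>)) \<longlonglongrightarrow> 0" by simp
    then show ?case
      using key unfolding S_def
      by (elim Lim_null_comparison[rotated]) (auto simp: eventually_at_top_linorder intro!: exI[of _ 1])
  qed
qed

end

text \<open>Summing the recursions telescopes: \<open>c\<close> times the sum of \<open>u\<close> is \<open>b\<close> times the sum of \<open>y\<close> up to
  boundary terms, and likewise the sum of \<open>v\<close> is determined by those of \<open>w\<close> and \<open>z\<close>. The lemma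
  covers both \<open>u = p\<close>, \<open>v = p\<^sup>2\<close> along a single path and the expectations of these.\<close>
lemma cumulation_average_limit:
  fixes u v w y z :: "nat \<Rightarrow> real"
  assumes c: "0 < c" "c \<le> 1" and b: "b = sqrt (c * (2 - c))"
    and u: "\<And>t. u (Suc t) = (1 - c) * u t + b * y t"
    and v: "\<And>t. v (Suc t) = (1 - c)\<^sup>2 * v t + 2 * (1 - c) * b * w t + b\<^sup>2 * z t"
    and y: "(\<lambda>t. (\<Sum>s<t. y s) / real t) \<longlonglongrightarrow> m"
    and z: "(\<lambda>t. (\<Sum>s<t. z s) / real t) \<longlonglongrightarrow> q"
    and w: "(\<lambda>t. (\<Sum>s<t. w s - m * u s) / real t) \<longlonglongrightarrow> 0"
    and u0: "(\<lambda>t. u t / real t) \<longlonglongrightarrow> 0" and v0: "(\<lambda>t. v t / real t) \<longlonglongrightarrow> 0"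
  shows "(\<lambda>t. (\<Sum>s<t. v (Suc s)) / real t) \<longlonglongrightarrow> 2 * (1 - c) * m\<^sup>2 / c + q"
proof -
  have b2: "b\<^sup>2 = c * (2 - c)" and b0: "b > 0" using c by (auto simp: b)
  have const: "(\<lambda>t. a / real t) \<longlonglongrightarrow> 0" for a :: real
    by (rule lim_const_over_n)
  have su: "c * (\<Sum>s<t. u s) = u 0 - u t + b * (\<Sum>s<t. y s)" for t
    by (induction t) (auto simp: u algebra_simps)
  \<comment> \<open>The factor on the left is 1 - (1 - c)^2, and shifting the index of
    \<open>v\<close> costs the boundary term \<open>v 0 - v t\<close>. The sum of \<open>w\<close>
    is split because only \<open>w s - m * u s\<close> is known to average to 0.\<close>
  have sv: "c * (2 - c) * (\<Sum>s<t. v (Suc s)) = (1 - c)\<^sup>2 * (v 0 - v t)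
      + 2 * (1 - c) * b * ((\<Sum>s<t. w s - m * u s) + m * (\<Sum>s<t. u s)) + b\<^sup>2 * (\<Sum>s<t. z s)" for t
    by (induction t) (auto simp: v algebra_simps power2_eq_square)
  have "(\<Sum>s<t. u s) / real t = (u 0 / real t - u t / real t + b * ((\<Sum>s<t. y s) / real t)) / c" for t
  proof -
    have "(\<Sum>s<t. u s) = (c * (\<Sum>s<t. u s)) / c" using c by simp
    then show ?thesis unfolding su by (simp add: add_divide_distrib diff_divide_distrib mult_ac)
  qed
  moreover have "(\<lambda>t. (u 0 / real t - u t / real t + b * ((\<Sum>s<t. y s) / real t)) / c) \<longlonglongrightarrow> (0 - 0 + b * m) / c"
    by (intro tendsto_intros const u0 y) (use c in auto)
  ultimately have ulim: "(\<lambda>t. (\<Sum>s<t. u s) / real t) \<longlonglongrightarrow> b * m / c" by simp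
  have eq: "(\<Sum>s<t. v (Suc s)) / real t = ((1 - c)\<^sup>2 * (v 0 / real t - v t / real t)
      + 2 * (1 - c) * b * ((\<Sum>s<t. w s - m * u s) / real t + m * ((\<Sum>s<t. u s) / real t))
      + b\<^sup>2 * ((\<Sum>s<t. z s) / real t)) / (c * (2 - c))" for t
  proof -
    define a e K where "a = (1 - c)\<^sup>2" and "e = 2 * (1 - c) * b" and "K = c * (2 - c)"
    have "K \<noteq> 0" using c by (simp add: K_def)
    then have "(\<Sum>s<t. v (Suc s)) = (K * (\<Sum>s<t. v (Suc s))) / K" by simp
    then show ?thesis unfolding sv[of t, folded a_def e_def K_def] a_def[symmetric] e_def[symmetric] K_def[symmetric]
      by (simp add: add_divide_distrib diff_divide_distrib distrib_left right_diff_distrib mult_ac)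
  qed
  have lim: "(\<lambda>t. ((1 - c)\<^sup>2 * (v 0 / real t - v t / real t)
      + 2 * (1 - c) * b * ((\<Sum>s<t. w s - m * u s) / real t + m * ((\<Sum>s<t. u s) / real t))
      + b\<^sup>2 * ((\<Sum>s<t. z s) / real t)) / (c * (2 - c))) \<longlonglongrightarrow>
      ((1 - c)\<^sup>2 * (0 - 0) + 2 * (1 - c) * b * (0 + m * (b * m / c)) + b\<^sup>2 * q) / (c * (2 - c))"
    by (intro tendsto_intros const v0 w ulim z) (use c in auto)
  \<comment> \<open>The mixed term carries b * b, one factor from the recursion for \<open>v\<close>
    and one from the limit b * m / c of the averages of \<open>u\<close>. Hence b^2 factors out and
    cancels against c * (2 - c).\<close>
  have "((1 - c)\<^sup>2 * (0 - 0) + 2 * (1 - c) * b * (0 + m * (b * m / c)) + b\<^sup>2 * q) / (c * (2 - c))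
      = 2 * (1 - c) * m\<^sup>2 / c + q"
  proof -
    have "(1 - c)\<^sup>2 * (0 - 0) + 2 * (1 - c) * b * (0 + m * (b * m / c)) + b\<^sup>2 * q
        = b\<^sup>2 * (2 * (1 - c) * m\<^sup>2 / c + q)"
      by (simp add: field_simps power2_eq_square)
    then show ?thesis using b0 by (simp flip: b2)
  qed
  then show ?thesis using lim unfolding eq by (simp only:)
qed

section \<open>The cumulative path\<close>

text \<open>The arithmetic-geometric mean inequality, applied to the two pairs and then to squares.
  It supplies an integrable bound for every product of up to four factors below.\<close>

lemma abs_product_le_fourth_powers:
  fixes a b c d :: real
  shows "\<bar>a * b * c * d\<bar> \<le> (a ^ 4 + b ^ 4 + c ^ 4 + d ^ 4) / 4"
proof -
  have *: "\<bar>x * y\<bar> \<le> (x\<^sup>2 + y\<^sup>2) / 2" for x y :: real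
    using sum_squares_bound[of "\<bar>x\<bar>" "\<bar>y\<bar>"] by (simp add: abs_mult)
  have "\<bar>a * b * c * d\<bar> = \<bar>(a * b) * (c * d)\<bar>" by (simp add: mult_ac)
  also have "\<dots> \<le> ((a * b)\<^sup>2 + (c * d)\<^sup>2) / 2" by (rule *)
  also have "\<dots> \<le> ((a ^ 4 + b ^ 4) / 2 + (c ^ 4 + d ^ 4) / 2) / 2"
    using *[of "a\<^sup>2" "b\<^sup>2"] *[of "c\<^sup>2" "d\<^sup>2"]
    by (simp add: power_mult_distrib flip: power_mult) (simp add: field_simps)
  finally show ?thesis by (simp add: field_simps)
qed

text \<open>The constant 8 = 2^2 * 2 comes from using (x + y)^2 \<le> 2 * (x^2 + y^2) twice.\<close>

lemma fourth_power_add_le: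
  fixes a b :: real
  shows "(a + b) ^ 4 \<le> 8 * (a ^ 4 + b ^ 4)"
proof -
  have *: "(x + y)\<^sup>2 \<le> 2 * (x\<^sup>2 + y\<^sup>2)" for x y :: real
    using sum_squares_bound[of x y] by (simp add: power2_sum)
  have "(a + b) ^ 4 = ((a + b)\<^sup>2)\<^sup>2" by simp
  also have "\<dots> \<le> (2 * (a\<^sup>2 + b\<^sup>2))\<^sup>2"
    using * by (intro power_mono) auto
  also have "\<dots> = 4 * (a\<^sup>2 + b\<^sup>2)\<^sup>2" by (simp only: power_mult_distrib) simp
  also have "\<dots> \<le> 4 * (2 * ((a\<^sup>2)\<^sup>2 + (b\<^sup>2)\<^sup>2))" by (intro mult_left_mono *) auto
  finally show ?thesis by simp
qed

lemma square_le_one_plus_fourth_power: "x\<^sup>2 \<le> 1 + x ^ 4" for x :: real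
  using sum_squares_bound[of "x\<^sup>2" 1] by simp (use zero_le_power2[of x] in linarith)

text \<open>Convexity, writing \<open>b * x\<close> as \<open>c * (b / c * x)\<close>; this keeps the fourth moments of the path
  bounded even though \<open>1 - c + b\<close> may exceed 1.\<close>
lemma cumulation_fourth_power_le:
  fixes c p x :: real
  assumes "0 < c" "c \<le> 1"
  shows "((1 - c) * p + b * x) ^ 4 \<le> (1 - c) * p ^ 4 + c * ((b / c) ^ 4 * x ^ 4)"
proof -
  have "((1 - c) *\<^sub>R p + c *\<^sub>R (b / c * x)) ^ 4 \<le> (1 - c) * p ^ 4 + c * (b / c * x) ^ 4"
    by (rule convex_onD[OF convex_power_even]) (use assms in auto)
  moreover have "(1 - c) *\<^sub>R p + c *\<^sub>R (b / c * x) = (1 - c) * p + b * x" using assms by simp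
  ultimately show ?thesis by (metis power_mult_distrib)
qed

section \<open>Finite fourth moments and orthogonality to the past\<close>

context prob_space begin

text \<open>Membership in L^4 is the single integrability notion carried through the proof: it is
  stable under sums and scaling, and by the product lemma below it yields every mixed moment that
  occurs.\<close>

definition fourth_moment :: "('a \<Rightarrow> real) \<Rightarrow> bool" where
  "fourth_moment X \<longleftrightarrow> X \<in> borel_measurable M \<and> integrable M (\<lambda>\<omega>. X \<omega> ^ 4)"

lemma fourth_moment_measurable: "fourth_moment X \<Longrightarrow> X \<in> borel_measurable M"
  and fourth_moment_integrable: "fourth_moment X \<Longrightarrow> integrable M (\<lambda>\<omega>. X \<omega> ^ 4)"
  by (auto simp: fourth_moment_def)

lemma fourth_moment_const: "fourth_moment (\<lambda>_. a)"
  by (simp add: fourth_moment_def)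

lemma fourth_moment_cmult: "fourth_moment X \<Longrightarrow> fourth_moment (\<lambda>\<omega>. a * X \<omega>)"
  by (auto simp: fourth_moment_def power_mult_distrib)

lemma fourth_moment_bound:
  assumes "Y \<in> borel_measurable M" "integrable M f" "\<And>\<omega>. Y \<omega> ^ 4 \<le> f \<omega>"
  shows "fourth_moment Y"
  unfolding fourth_moment_def
proof
  show "integrable M (\<lambda>\<omega>. Y \<omega> ^ 4)"
    using assms by (intro Bochner_Integration.integrable_bound[OF assms(2)])
      (auto intro: order_trans[OF assms(3) abs_ge_self])
qed fact

lemma fourth_moment_add:
  assumes "fourth_moment X" "fourth_moment Y"
  shows "fourth_moment (\<lambda>\<omega>. X \<omega> + Y \<omega>)"
proof (rule fourth_moment_bound)
  show "integrable M (\<lambda>\<omega>. 8 * (X \<omega> ^ 4 + Y \<omega> ^ 4))"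
    using assms[THEN fourth_moment_integrable] by auto
qed (use assms[THEN fourth_moment_measurable] in \<open>auto simp del: distrib_left_numeral intro: fourth_power_add_le\<close>)

lemma fourth_moment_integrable_product:
  assumes "fourth_moment X" "fourth_moment Y" "fourth_moment V" "fourth_moment W"
  shows "integrable M (\<lambda>\<omega>. X \<omega> * Y \<omega> * V \<omega> * W \<omega>)"
proof (rule Bochner_Integration.integrable_bound)
  show "integrable M (\<lambda>\<omega>. (X \<omega> ^ 4 + Y \<omega> ^ 4 + V \<omega> ^ 4 + W \<omega> ^ 4) / 4)"
    using assms[THEN fourth_moment_integrable] by auto
  have "\<bar>X \<omega> * Y \<omega> * V \<omega> * W \<omega>\<bar> \<le> \<bar>(X \<omega> ^ 4 + Y \<omega> ^ 4 + V \<omega> ^ 4 + W \<omega> ^ 4) / 4\<bar>" for \<omega>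
    using abs_product_le_fourth_powers by (rule order_trans) (rule abs_ge_self)
  then show "AE \<omega> in M. norm (X \<omega> * Y \<omega> * V \<omega> * W \<omega>) \<le> norm ((X \<omega> ^ 4 + Y \<omega> ^ 4 + V \<omega> ^ 4 + W \<omega> ^ 4) / 4)"
    by simp
qed (use assms[THEN fourth_moment_measurable] in auto)

lemma fourth_moment_integrable_square: "fourth_moment X \<Longrightarrow> integrable M (\<lambda>\<omega>. (X \<omega>)\<^sup>2)"
  and fourth_moment_integrable_self: "fourth_moment X \<Longrightarrow> integrable M X"
  using fourth_moment_integrable_product[of X X "\<lambda>_. 1" "\<lambda>_. 1"]
    fourth_moment_integrable_product[of X "\<lambda>_. 1" "\<lambda>_. 1" "\<lambda>_. 1"] fourth_moment_const
  by (auto simp: power2_eq_square)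

text \<open>The values up to time \<open>t\<close> and the value at \<open>Suc t\<close> use
  disjoint index sets, so the expectation of the product factorises and the centred factor kills it.
  \<open>Y\<close> is presented through a function \<open>G\<close> of the restricted sequence, so
  that its dependence on the past alone can be checked by computation. All orthogonality claims
  about the path rest on this.\<close>

lemma indep_vars_past_uncorrelated:
  fixes W :: "nat \<Rightarrow> 'a \<Rightarrow> real" and Y :: "'a \<Rightarrow> real" and g :: "real \<Rightarrow> real"
  assumes indep: "indep_vars (\<lambda>_. borel) W UNIV"
    and G: "G \<in> borel_measurable (PiM {..t} (\<lambda>_. borel))"
    and G': "\<And>\<omega>. G (restrict (\<lambda>i. W i \<omega>) {..t}) = Y \<omega>"
    and g: "g \<in> borel_measurable borel" "integrable M (\<lambda>\<omega>. g (W (Suc t) \<omega>))"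
      "expectation (\<lambda>\<omega>. g (W (Suc t) \<omega>)) = 0"
    and Y: "integrable M Y"
  shows "expectation (\<lambda>\<omega>. Y \<omega> * g (W (Suc t) \<omega>)) = 0"
proof -
  have "indep_var (PiM {..t} (\<lambda>_. borel)) (\<lambda>\<omega>. restrict (\<lambda>i. W i \<omega>) {..t})
      (PiM {Suc t} (\<lambda>_. borel)) (\<lambda>\<omega>. restrict (\<lambda>i. W i \<omega>) {Suc t})"
    by (rule indep_var_restrict[OF indep]) auto
  from indep_var_compose[OF this, of G borel "\<lambda>f. g (f (Suc t))" borel]
  have "indep_var borel Y borel (\<lambda>\<omega>. g (W (Suc t) \<omega>))"
    using G g(1) by (simp add: comp_def G')
  from indep_var_lebesgue_integral[OF this Y g(2)] show ?thesis by (simp add: g(3))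
qed

end

text \<open>\<open>W 0\<close> is the initial path value and \<open>W (Suc t)\<close> the step
  selected at time \<open>t\<close>; this shift accounts for every \<open>Suc\<close> in the moment
  conditions below.\<close>

primrec cumulation :: "real \<Rightarrow> (nat \<Rightarrow> real) \<Rightarrow> nat \<Rightarrow> real" where
  "cumulation c W 0 = W 0"
| "cumulation c W (Suc t) = (1 - c) * cumulation c W t + sqrt (c * (2 - c)) * W (Suc t)"

lemma cumulation_restrict:
  "t \<le> k \<Longrightarrow> cumulation c (restrict W {..k}) t = cumulation c W t"
  by (induction t) auto

lemma measurable_cumulation [measurable]:
  "t \<le> k \<Longrightarrow> (\<lambda>W. cumulation c W t) \<in> borel_measurable (PiM {..k} (\<lambda>_. borel))"
  by (induction t) auto

context prob_space begin

text \<open>Mean and second moment are prescribed only from index 1 on, since \<open>W 0\<close>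
  follows the starting law; the uniform fourth-moment bound includes it.\<close>

lemma
  fixes W :: "nat \<Rightarrow> 'a \<Rightarrow> real" and c :: real
  defines "p \<equiv> \<lambda>t \<omega>. cumulation c (\<lambda>i. W i \<omega>) t"
  assumes c: "0 < c" "c \<le> 1"
    and indep: "indep_vars (\<lambda>_. borel) W UNIV"
    and fourth: "\<And>t. fourth_moment (W t)"
    and bound: "\<And>t. expectation (\<lambda>\<omega>. W t \<omega> ^ 4) \<le> K"
    and mean: "\<And>t. expectation (W (Suc t)) = m"
    and second: "\<And>t. expectation (\<lambda>\<omega>. (W (Suc t) \<omega>)\<^sup>2) = q"
  shows cumulation_fourth_moment: "fourth_moment (p t)"
    and cumulation_square_AE: "AE \<omega> in M. (\<lambda>t. (\<Sum>s<t. (p (Suc s) \<omega>)\<^sup>2) / real t) \<longlonglongrightarrow> 2 * (1 - c) * m\<^sup>2 / c + q"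
    and cumulation_square_expectation:
      "(\<lambda>t. (\<Sum>s<t. expectation (\<lambda>\<omega>. (p (Suc s) \<omega>)\<^sup>2)) / real t) \<longlonglongrightarrow> 2 * (1 - c) * m\<^sup>2 / c + q"
proof -
  define b where "b = sqrt (c * (2 - c))"
  have pSuc: "p (Suc t) \<omega> = (1 - c) * p t \<omega> + b * W (Suc t) \<omega>" for t \<omega>
    by (simp add: p_def b_def)
  have fp: "fourth_moment (p t)" for t
  proof (induction t)
    case 0
    then show ?case using fourth[of 0] by (simp add: p_def)
  next
    case (Suc t)
    then show ?case unfolding pSuc by (intro fourth_moment_add fourth_moment_cmult fourth)
  qed
  then show "fourth_moment (p t)" .
  note int4 = fourth_moment_integrable_product
  note int2 = fourth_moment_integrable_square and int1 = fourth_moment_integrable_self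
  \<comment> \<open>The first argument of the maximum covers the start of the induction, the second
    the contribution of a new step. The convex combination (1 - c) * K' + c * K' then reproduces
    K'.\<close>
  define K' where "K' = max K ((b / c) ^ 4 * K)"
  have bound_p: "expectation (\<lambda>\<omega>. p t \<omega> ^ 4) \<le> K'" for t
  proof (induction t)
    case 0
    then show ?case using bound[of 0] by (simp add: p_def K'_def)
  next
    case (Suc t)
    have "expectation (\<lambda>\<omega>. p (Suc t) \<omega> ^ 4)
        \<le> expectation (\<lambda>\<omega>. (1 - c) * p t \<omega> ^ 4 + c * ((b / c) ^ 4 * W (Suc t) \<omega> ^ 4))"
      using fourth_moment_integrable[OF fp[of "Suc t"]] unfolding pSuc
      by (intro integral_mono Bochner_Integration.integrable_add integrable_mult_right
          fourth_moment_integrable[OF fp] fourth_moment_integrable[OF fourth] cumulation_fourth_power_le c)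
    also have "\<dots> = (1 - c) * expectation (\<lambda>\<omega>. p t \<omega> ^ 4)
        + c * ((b / c) ^ 4 * expectation (\<lambda>\<omega>. W (Suc t) \<omega> ^ 4))"
      using fp fourth by (simp add: fourth_moment_integrable)
    also have "\<dots> \<le> (1 - c) * K' + c * K'"
    proof (intro add_mono mult_left_mono Suc)
      have "(b / c) ^ 4 * expectation (\<lambda>\<omega>. W (Suc t) \<omega> ^ 4) \<le> (b / c) ^ 4 * K"
        by (intro mult_left_mono bound) (auto simp: zero_le_even_power)
      then show "(b / c) ^ 4 * expectation (\<lambda>\<omega>. W (Suc t) \<omega> ^ 4) \<le> K'" by (simp add: K'_def)
    qed (use c in auto)
    finally show ?case by (simp add: algebra_simps)
  qed
  \<comment> \<open>\<open>y t\<close> and the later \<open>z t\<close> are functions of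
    \<open>W (Suc t)\<close>, so they are orthogonal to everything built from \<open>W\<close> up to
    index \<open>t\<close>. For \<open>s < t\<close> this includes \<open>y s\<close> and
    \<open>z s\<close>, because \<open>Suc s \<le> t\<close>.\<close>
  define y where "y t \<omega> = W (Suc t) \<omega> - m" for t \<omega>
  have fy: "fourth_moment (y t)" for t
    unfolding y_def using fourth_moment_add[OF fourth fourth_moment_const, of _ "- m"] by simp
  have Ey: "expectation (y t) = 0" for t
    unfolding y_def using int1[OF fourth] by (simp add: mean prob_space)
  define z where "z t \<omega> = (W (Suc t) \<omega>)\<^sup>2 - q" for t \<omega>
  have Iz: "integrable M (z t)" for t
    unfolding z_def using int2[OF fourth] by simp
  have Ez: "expectation (z t) = 0" for t
    unfolding z_def using int2[OF fourth] by (simp add: second prob_space)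
  have z2: "integrable M (\<lambda>\<omega>. z s \<omega> * z t \<omega>)" for s t
  proof -
    have "z s \<omega> * z t \<omega> = W (Suc s) \<omega> * W (Suc s) \<omega> * W (Suc t) \<omega> * W (Suc t) \<omega>
        - q * (W (Suc s) \<omega>)\<^sup>2 - q * (W (Suc t) \<omega>)\<^sup>2 + q * q" for \<omega>
      by (simp add: z_def algebra_simps power2_eq_square)
    then show ?thesis using int4[OF fourth fourth fourth fourth] int2[OF fourth] by simp
  qed
  note past = indep_vars_past_uncorrelated[OF indep]
  have lawz: "AE \<omega> in M. (\<lambda>t. (\<Sum>s<t. z s \<omega>) / real t) \<longlonglongrightarrow> 0"
  proof (rule strong_law_orthogonal[OF z2])
    show "expectation (\<lambda>\<omega>. z s \<omega> * z t \<omega>) = 0" if "s < t" for s t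
      unfolding z_def[of t]
      by (rule past[where t = t and G = "\<lambda>W. (W (Suc s))\<^sup>2 - q" and g = "\<lambda>x. x\<^sup>2 - q"])
        (use that Iz[unfolded z_def] Ez[unfolded z_def] in \<open>auto simp: z_def\<close>)
    show "expectation (\<lambda>\<omega>. (z t \<omega>)\<^sup>2) \<le> 2 * K + 2 * q\<^sup>2" for t
    proof -
      have "expectation (\<lambda>\<omega>. (z t \<omega>)\<^sup>2) \<le> expectation (\<lambda>\<omega>. 2 * W (Suc t) \<omega> ^ 4 + 2 * q\<^sup>2)"
      proof (intro integral_mono)
        fix \<omega>
        show "(z t \<omega>)\<^sup>2 \<le> 2 * W (Suc t) \<omega> ^ 4 + 2 * q\<^sup>2"
          using zero_le_power2[of "(W (Suc t) \<omega>)\<^sup>2 + q"] unfolding z_def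
          by (simp add: power2_sum power2_diff)
      qed (use z2 fourth in \<open>auto simp: power2_eq_square[of "z t _"] fourth_moment_integrable\<close>)
      also have "\<dots> \<le> 2 * K + 2 * q\<^sup>2"
        using bound[of "Suc t"] fourth by (simp add: fourth_moment_integrable prob_space)
      finally show ?thesis .
    qed
  qed
  have y4: "expectation (\<lambda>\<omega>. y t \<omega> ^ 4) \<le> 8 * (K + m ^ 4)" for t
  proof -
    have "expectation (\<lambda>\<omega>. y t \<omega> ^ 4) \<le> expectation (\<lambda>\<omega>. 8 * (W (Suc t) \<omega> ^ 4 + m ^ 4))"
      using fourth_power_add_le[of "W (Suc t) _" "- m"] fourth fourth_moment_integrable[OF fy, of t]
      by (intro integral_mono) (auto simp: fourth_moment_integrable y_def)
    also have "\<dots> \<le> 8 * (K + m ^ 4)"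
      using bound[of "Suc t"] fourth by (simp add: fourth_moment_integrable prob_space)
    finally show ?thesis .
  qed
  have yy: "integrable M (\<lambda>\<omega>. y s \<omega> * y t \<omega>)" for s t
    using int4[OF fy fy fourth_moment_const[of 1] fourth_moment_const[of 1]] by simp
  have lawy: "AE \<omega> in M. (\<lambda>t. (\<Sum>s<t. y s \<omega>) / real t) \<longlonglongrightarrow> 0"
  proof (rule strong_law_orthogonal[OF yy])
    show "expectation (\<lambda>\<omega>. y s \<omega> * y t \<omega>) = 0" if "s < t" for s t
      unfolding y_def[of t]
      by (rule past[where t = t and G = "\<lambda>W. W (Suc s) - m" and g = "\<lambda>x. x - m"])
        (use that int1[OF fy, unfolded y_def] Ey[unfolded y_def] in \<open>auto simp: y_def\<close>)
    show "expectation (\<lambda>\<omega>. (y t \<omega>)\<^sup>2) \<le> 1 + 8 * (K + m ^ 4)" for t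
    proof -
      have "expectation (\<lambda>\<omega>. (y t \<omega>)\<^sup>2) \<le> expectation (\<lambda>\<omega>. 1 + y t \<omega> ^ 4)"
        using fy int2[OF fy]
        by (intro integral_mono square_le_one_plus_fourth_power) (auto simp: fourth_moment_integrable)
      also have "\<dots> \<le> 1 + 8 * (K + m ^ 4)"
        using y4[of t] fy by (simp add: fourth_moment_integrable prob_space)
      finally show ?thesis .
    qed
  qed
  have pypy: "integrable M (\<lambda>\<omega>. (p s \<omega> * y s \<omega>) * (p t \<omega> * y t \<omega>))" for s t
    using int4[OF fp fy fp fy] by (simp add: mult_ac)
  have lawpy: "AE \<omega> in M. (\<lambda>t. (\<Sum>s<t. p s \<omega> * y s \<omega>) / real t) \<longlonglongrightarrow> 0"
  proof (rule strong_law_orthogonal[OF pypy])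
    show "expectation (\<lambda>\<omega>. (p s \<omega> * y s \<omega>) * (p t \<omega> * y t \<omega>)) = 0" if "s < t" for s t
    proof -
      \<comment> \<open>Regrouping puts both path values and \<open>y s\<close> into the past of
        time \<open>t\<close>, leaving the centred step at \<open>Suc t\<close> as the other
        factor.\<close>
      have "expectation (\<lambda>\<omega>. (p s \<omega> * y s \<omega> * p t \<omega>) * (W (Suc t) \<omega> - m)) = 0"
      proof (rule past[where t = t and g = "\<lambda>x. x - m" and
            G = "\<lambda>W. cumulation c W s * (W (Suc s) - m) * cumulation c W t"])
        show "integrable M (\<lambda>\<omega>. p s \<omega> * y s \<omega> * p t \<omega>)"
          using int4[OF fp fy fp fourth_moment_const[of 1]] by simp
      qed (use that int1[OF fy, unfolded y_def] Ey[unfolded y_def] in \<open>auto simp: y_def p_def cumulation_restrict\<close>)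
      then show ?thesis by (simp add: y_def mult_ac)
    qed
    show "expectation (\<lambda>\<omega>. (p t \<omega> * y t \<omega>)\<^sup>2) \<le> (K' + 8 * (K + m ^ 4)) / 2" for t
    proof -
      have "expectation (\<lambda>\<omega>. (p t \<omega> * y t \<omega>)\<^sup>2) \<le> expectation (\<lambda>\<omega>. (p t \<omega> ^ 4 + y t \<omega> ^ 4) / 2)"
      proof (intro integral_mono)
        fix \<omega>
        show "(p t \<omega> * y t \<omega>)\<^sup>2 \<le> (p t \<omega> ^ 4 + y t \<omega> ^ 4) / 2"
          using abs_product_le_fourth_powers[of "p t \<omega>" "p t \<omega>" "y t \<omega>" "y t \<omega>"]
          by (simp add: power2_eq_square mult_ac)
      qed (use pypy[of t t] fp fy in \<open>auto simp: power2_eq_square fourth_moment_integrable\<close>)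
      also have "\<dots> \<le> (K' + 8 * (K + m ^ 4)) / 2"
        using bound_p[of t] y4[of t] fp fy by (simp add: fourth_moment_integrable)
      finally show ?thesis .
    qed
  qed
  \<comment> \<open>The squares alone would not do: E p^2 / t is merely bounded by a multiple of 1 /
    t. Passing to fourth powers makes the bound K' / t^2 summable, and a square root returns to p^2
    / t.\<close>
  have "AE \<omega> in M. (\<lambda>t. p t \<omega> ^ 4 / (real t)\<^sup>2) \<longlonglongrightarrow> 0"
  proof (rule AE_tendsto_0_if_summable_expectation)
    show "summable (\<lambda>k. K' * inverse (real k ^ 2))"
      by (intro summable_mult inverse_power_summable) auto
    show "expectation (\<lambda>\<omega>. p t \<omega> ^ 4 / (real t)\<^sup>2) \<le> K' * inverse (real t ^ 2)" for t
      using bound_p[of t] by (simp add: divide_inverse mult_right_mono)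
  qed (use fp in \<open>auto simp: fourth_moment_integrable\<close>)
  then have p0: "AE \<omega> in M. (\<lambda>t. (p t \<omega>)\<^sup>2 / real t) \<longlonglongrightarrow> 0"
  proof eventually_elim
    case (elim \<omega>)
    then have "(\<lambda>t. sqrt (p t \<omega> ^ 4 / (real t)\<^sup>2)) \<longlonglongrightarrow> sqrt 0" by (rule tendsto_real_sqrt)
    moreover have "sqrt (p t \<omega> ^ 4 / (real t)\<^sup>2) = (p t \<omega>)\<^sup>2 / real t" for t
    proof -
      have "p t \<omega> ^ 4 / (real t)\<^sup>2 = ((p t \<omega>)\<^sup>2 / real t)\<^sup>2" by (simp add: power_divide)
      then show ?thesis by simp
    qed
    ultimately show ?case by simp
  qed
  show "AE \<omega> in M. (\<lambda>t. (\<Sum>s<t. (p (Suc s) \<omega>)\<^sup>2) / real t) \<longlonglongrightarrow> 2 * (1 - c) * m\<^sup>2 / c + q"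
    using lawz lawy lawpy p0
  proof eventually_elim
    case (elim \<omega>)
    have avg: "(\<lambda>t. (\<Sum>s<t. f s) / real t) \<longlonglongrightarrow> a" if "(\<lambda>t. (\<Sum>s<t. f s - a) / real t) \<longlonglongrightarrow> 0"
      for f :: "nat \<Rightarrow> real" and a
    proof -
      have "(\<lambda>t. (\<Sum>s<t. f s - a) / real t + a) \<longlonglongrightarrow> 0 + a"
        by (intro tendsto_intros that)
      moreover have "\<forall>\<^sub>F t in sequentially. (\<Sum>s<t. f s - a) / real t + a = (\<Sum>s<t. f s) / real t"
        using eventually_gt_at_top[of 0] by eventually_elim (simp add: sum_subtractf field_simps)
      ultimately show ?thesis by (auto dest: tendsto_cong)
    qed
    show ?case
    proof (rule cumulation_average_limit[OF c refl, where u = "\<lambda>t. p t \<omega>" and y = "\<lambda>t. W (Suc t) \<omega>"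
          and w = "\<lambda>t. p t \<omega> * W (Suc t) \<omega>" and z = "\<lambda>t. (W (Suc t) \<omega>)\<^sup>2"])
      have "(\<lambda>t. (p t \<omega>)\<^sup>2 / real t + 1 / real t) \<longlonglongrightarrow> 0 + 0"
        by (intro tendsto_add elim lim_const_over_n)
      then have "(\<lambda>t. ((p t \<omega>)\<^sup>2 + 1) / real t) \<longlonglongrightarrow> 0" by (simp add: add_divide_distrib)
      then show "(\<lambda>t. p t \<omega> / real t) \<longlonglongrightarrow> 0"
      proof (rule Lim_null_comparison[rotated], intro always_eventually allI)
        fix t
        have "\<bar>p t \<omega>\<bar> \<le> (p t \<omega>)\<^sup>2 + 1"
          using sum_squares_bound[of "\<bar>p t \<omega>\<bar>" 1] by simp
        then show "norm (p t \<omega> / real t) \<le> ((p t \<omega>)\<^sup>2 + 1) / real t"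
          by (simp add: divide_right_mono)
      qed
      show "(\<lambda>t. (\<Sum>s<t. p s \<omega> * W (Suc s) \<omega> - m * p s \<omega>) / real t) \<longlonglongrightarrow> 0"
        using elim(3) by (simp add: y_def algebra_simps)
    qed (use elim in \<open>auto simp: pSuc b_def y_def z_def intro!: avg simp: power2_sum power_mult_distrib\<close>)
  qed
  have bounded: "(\<lambda>t. a t / real t) \<longlonglongrightarrow> 0" if "\<And>t. \<bar>a t\<bar> \<le> 1 + K'" for a :: "nat \<Rightarrow> real"
  proof (rule Lim_null_comparison[OF _ lim_const_over_n[of "1 + K'"]])
    show "\<forall>\<^sub>F t in sequentially. norm (a t / real t) \<le> (1 + K') / real t"
      using that by (simp add: divide_right_mono)
  qed
  \<comment> \<open>In expectation the martingale term is exactly zero, so the averaging lemma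
    applies again with constant sequences for \<open>y\<close> and \<open>z\<close>.\<close>
  have pW: "expectation (\<lambda>\<omega>. p t \<omega> * W (Suc t) \<omega>) = m * expectation (p t)" for t
  proof -
    have "expectation (\<lambda>\<omega>. p t \<omega> * (W (Suc t) \<omega> - m)) = 0"
      by (rule past[where t = t and g = "\<lambda>x. x - m" and G = "\<lambda>W. cumulation c W t"])
        (use int1[OF fp] int1[OF fy, unfolded y_def] Ey[unfolded y_def] in \<open>auto simp: y_def p_def cumulation_restrict\<close>)
    moreover have "integrable M (\<lambda>\<omega>. p t \<omega> * W (Suc t) \<omega>)"
      using int4[OF fp fourth fourth_moment_const[of 1] fourth_moment_const[of 1]] by simp
    ultimately show ?thesis using int1[OF fp] by (simp add: right_diff_distrib mult.commute)
  qed
  have sq_le: "expectation (\<lambda>\<omega>. (p t \<omega>)\<^sup>2) \<le> 1 + K'" for t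
  proof -
    have "expectation (\<lambda>\<omega>. (p t \<omega>)\<^sup>2) \<le> expectation (\<lambda>\<omega>. 1 + p t \<omega> ^ 4)"
      using fp int2[OF fp]
      by (intro integral_mono square_le_one_plus_fourth_power) (auto simp: fourth_moment_integrable)
    also have "\<dots> \<le> 1 + K'" using bound_p[of t] fp by (simp add: fourth_moment_integrable prob_space)
    finally show ?thesis .
  qed
  have avgc: "(\<lambda>t. (\<Sum>s<t. a) / real t) \<longlonglongrightarrow> a" for a :: real
    by (rule tendsto_eventually) (auto simp: eventually_at_top_linorder intro!: exI[of _ 1])
  show "(\<lambda>t. (\<Sum>s<t. expectation (\<lambda>\<omega>. (p (Suc s) \<omega>)\<^sup>2)) / real t) \<longlonglongrightarrow> 2 * (1 - c) * m\<^sup>2 / c + q"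
  proof (rule cumulation_average_limit[OF c b_def, where u = "\<lambda>t. expectation (p t)" and y = "\<lambda>_. m"
          and w = "\<lambda>t. m * expectation (p t)" and z = "\<lambda>_. q" and v = "\<lambda>t. expectation (\<lambda>\<omega>. (p t \<omega>)\<^sup>2)"])
    show "expectation (p (Suc t)) = (1 - c) * expectation (p t) + b * m" for t
    proof -
      have "p (Suc t) = (\<lambda>\<omega>. (1 - c) * p t \<omega> + b * W (Suc t) \<omega>)" by (rule ext) (rule pSuc)
      then show ?thesis using int1[OF fp] int1[OF fourth] by (simp add: mean)
    qed
    show "expectation (\<lambda>\<omega>. (p (Suc t) \<omega>)\<^sup>2) = (1 - c)\<^sup>2 * expectation (\<lambda>\<omega>. (p t \<omega>)\<^sup>2)
        + 2 * (1 - c) * b * (m * expectation (p t)) + b\<^sup>2 * q" for t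
    proof -
      have "(p (Suc t) \<omega>)\<^sup>2 = (1 - c)\<^sup>2 * (p t \<omega>)\<^sup>2 + 2 * (1 - c) * b * (p t \<omega> * W (Suc t) \<omega>)
          + b\<^sup>2 * (W (Suc t) \<omega>)\<^sup>2" for \<omega>
        by (simp add: pSuc power2_sum power_mult_distrib)
      moreover have "integrable M (\<lambda>\<omega>. p t \<omega> * W (Suc t) \<omega>)"
        using int4[OF fp fourth fourth_moment_const[of 1] fourth_moment_const[of 1]] by simp
      ultimately show ?thesis using int2[OF fp] int2[OF fourth] by (simp add: pW second)
    qed
    show "(\<lambda>t. expectation (p t) / real t) \<longlonglongrightarrow> 0"
    proof (rule bounded)
      fix t
      have "(expectation (p t))\<^sup>2 \<le> expectation (\<lambda>\<omega>. (p t \<omega>)\<^sup>2)"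
        using variance_eq[OF int1[OF fp] int2[OF fp], of t] variance_positive[of "p t"] by linarith
      then have "(expectation (p t))\<^sup>2 \<le> 1 + K'" using sq_le[of t] by linarith
      moreover have "0 \<le> K'" using bound_p[of 0] by (rule order_trans[rotated]) (simp add: zero_le_even_power)
      moreover have "\<bar>x\<bar> \<le> B" if "x\<^sup>2 \<le> B" "1 \<le> B" for x B :: real
      proof -
        have "B \<le> B\<^sup>2" using that by (intro self_le_power) auto
        then have "x\<^sup>2 \<le> B\<^sup>2" using that by linarith
        then show ?thesis using that abs_le_square_iff[of x B] by simp
      qed
      ultimately show "\<bar>expectation (p t)\<bar> \<le> 1 + K'" by simp
    qed
    show "(\<lambda>t. expectation (\<lambda>\<omega>. (p t \<omega>)\<^sup>2) / real t) \<longlonglongrightarrow> 0"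
      using sq_le by (intro bounded) simp
  qed (use avgc in auto)
qed

end

section \<open>The minimum of independent standard normal variables\<close>

abbreviation std_normal :: "real measure" where
  "std_normal \<equiv> density lborel (\<lambda>x. ennreal (std_normal_density x))"

interpretation std_normal: prob_space std_normal
  by (rule prob_space_normal_density) simp

lemma Collect_interval: "{x. u < x \<and> x < v} = {u<..<v}"
  by auto

text \<open>The density is positive everywhere, so an interval that is null for the normal law would
  be null for Lebesgue measure too.\<close>

lemma std_normal_interval_pos:
  assumes "u < v"
  shows "0 < measure std_normal {u<..<v}"
proof -
  have "emeasure std_normal {u<..<v} \<noteq> 0"
  proof
    assume "emeasure std_normal {u<..<v} = 0"
    then have "AE x in lborel. \<not> (u < x \<and> x < v)"
      by (subst (asm) emeasure_density)
        (auto simp: nn_integral_0_iff_AE indicator_def normal_density_pos less_imp_neq[symmetric]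
          elim!: eventually_mono split: if_splits)
    then have "emeasure lborel {u<..<v} = 0"
      by (subst (asm) AE_iff_measurable[OF _ refl]) (auto simp: Collect_interval)
    with assms show False by simp
  qed
  then show ?thesis by (simp add: std_normal.emeasure_eq_measure zero_less_measure_iff)
qed

lemma std_normal_reflect: "measure std_normal {..<-a} = measure std_normal {a<..}"
proof -
  have "emeasure std_normal {..<-a} = emeasure std_normal {a<..}"
    using nn_integral_real_affine[of "\<lambda>x. ennreal (std_normal_density x) * indicator {..<-a} x" "-1" 0]
    by (simp add: emeasure_density normal_density_def indicator_def)
  then show ?thesis by (simp add: measure_def)
qed

lemma std_normal_atLeast: "measure std_normal {-a..} = 1 - measure std_normal {a<..}"
proof -
  have "measure std_normal (space std_normal - {..<-a}) = 1 - measure std_normal {..<-a}"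
    by (rule std_normal.prob_compl) simp
  moreover have "space std_normal - {..<-a} = {-a..}" by auto
  ultimately show ?thesis by (simp add: std_normal_reflect)
qed

text \<open>The two tails have equal mass and the interval between them has positive mass, which
  makes the bound 1 / 2 strict. The strict comparison for three or more children depends on
  this.\<close>

lemma std_normal_upper_tail:
  assumes "0 < a"
  shows "0 < measure std_normal {a<..}" "measure std_normal {a<..} < 1 / 2"
proof -
  show "0 < measure std_normal {a<..}"
    by (rule less_le_trans[OF std_normal_interval_pos[of a "a + 1"]])
      (auto intro!: std_normal.finite_measure_mono)
  have "measure std_normal ({..<-a} \<union> {-a<..<a} \<union> {a<..})
      = measure std_normal {..<-a} + measure std_normal {-a<..<a} + measure std_normal {a<..}"
    using assms by (subst std_normal.finite_measure_Union, simp, simp, force)+ simp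
  moreover have "measure std_normal ({..<-a} \<union> {-a<..<a} \<union> {a<..}) \<le> 1" by (rule std_normal.prob_le_1)
  moreover have "0 < measure std_normal {-a<..<a}" using assms by (intro std_normal_interval_pos) simp
  ultimately show "measure std_normal {a<..} < 1 / 2" using std_normal_reflect[of a] by linarith
qed

text \<open>The tail is monotone in \<open>s\<close>, hence Borel; this allows tails to be
  integrated over the level \<open>s\<close>.\<close>

lemma measurable_std_normal_upper_tail:
  "(\<lambda>s. measure std_normal {sqrt s<..}) \<in> borel_measurable borel"
proof -
  have "mono (\<lambda>s. - measure std_normal {sqrt s<..})"
    by (auto intro!: monoI std_normal.finite_measure_mono intro: order.strict_trans1)
  then have "(\<lambda>s. - measure std_normal {sqrt s<..}) \<in> borel_measurable borel" by (rule borel_measurable_mono)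
  from borel_measurable_uminus[OF this] show ?thesis by simp
qed

text \<open>The expression \<open>1 + Q ^ k - (1 - Q) ^ k\<close> is the probability that the minimum of \<open>k\<close>
  independent standard normal variables exceeds \<open>a\<close> in absolute value, where \<open>Q\<close> is the upper
  tail at \<open>a\<close>; for a single variable it equals \<open>2 * Q\<close>.\<close>
lemma two_sided_tail_Suc:
  fixes Q :: real
  shows "(1 + Q ^ Suc k - (1 - Q) ^ Suc k) - (1 + Q ^ k - (1 - Q) ^ k) = (1 - Q) ^ k * Q - Q ^ k * (1 - Q)"
  by (simp add: algebra_simps)

text \<open>Each increment factors as Q * (1 - Q) * ((1 - Q)^i - Q^i), which is nonnegative for Q
  \<le> 1 / 2. Equality holds at k = 1.\<close>

lemma two_sided_tail_ge:
  fixes Q :: real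
  assumes Q: "0 \<le> Q" "Q \<le> 1 / 2" and "1 \<le> k"
  shows "2 * Q \<le> 1 + Q ^ k - (1 - Q) ^ k"
  using \<open>1 \<le> k\<close>
proof (induction k rule: dec_induct)
  case (step k)
  obtain i where k: "k = Suc i" using step by (cases k) auto
  have "(1 - Q) ^ k * Q - Q ^ k * (1 - Q) = Q * (1 - Q) * ((1 - Q) ^ i - Q ^ i)"
    by (simp add: k algebra_simps)
  moreover have "Q ^ i \<le> (1 - Q) ^ i" using Q by (intro power_mono) auto
  ultimately have "0 \<le> (1 - Q) ^ k * Q - Q ^ k * (1 - Q)" using Q by simp
  then show ?case using step.IH two_sided_tail_Suc[of Q k] by linarith
qed simp

text \<open>The increment from k = 1 to k = 2 has i = 0 and vanishes, so strictness can begin only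
  at k = 3; there the last increment has a positive exponent.\<close>

lemma two_sided_tail_greater:
  fixes Q :: real
  assumes Q: "0 < Q" "Q < 1 / 2" and "3 \<le> k"
  shows "2 * Q < 1 + Q ^ k - (1 - Q) ^ k"
proof -
  obtain i where k: "k = Suc (Suc (Suc i))" using \<open>3 \<le> k\<close> by (metis Suc_le_D numeral_3_eq_3 Suc_le_mono)
  have "(1 - Q) ^ Suc (Suc i) * Q - Q ^ Suc (Suc i) * (1 - Q) = Q * (1 - Q) * ((1 - Q) ^ Suc i - Q ^ Suc i)"
    by (simp add: algebra_simps)
  moreover have "Q ^ Suc i < (1 - Q) ^ Suc i" using Q by (intro power_strict_mono) auto
  ultimately have "0 < (1 - Q) ^ Suc (Suc i) * Q - Q ^ Suc (Suc i) * (1 - Q)" using Q by simp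
  then show ?thesis using two_sided_tail_ge[of Q "Suc (Suc i)"] two_sided_tail_Suc[of Q "Suc (Suc i)"] Q
    unfolding k by linarith
qed

section \<open>Moments of the minimum by integration of tails\<close>

context prob_space begin

lemma std_normal_distr:
  assumes "distributed M lborel X (\<lambda>x. ennreal (std_normal_density x))"
  shows "X \<in> borel_measurable M" and "distr M borel X = std_normal"
  using distributed_measurable[OF assms] distributed_distr_eq_density[OF assms]
  by (simp_all cong: distr_cong)

lemma std_normal_prob:
  assumes "distributed M lborel X (\<lambda>x. ennreal (std_normal_density x))" "A \<in> sets borel"
  shows "prob (X -` A \<inter> space M) = measure std_normal A"
  using measure_distr[OF std_normal_distr(1)[OF assms(1)] assms(2)] std_normal_distr(2)[OF assms(1)]
  by simp

lemma std_normal_moments: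
  assumes X: "distributed M lborel X (\<lambda>x. ennreal (std_normal_density x))"
  shows "fourth_moment X" "expectation X = 0" "expectation (\<lambda>\<omega>. (X \<omega>)\<^sup>2) = 1"
    "expectation (\<lambda>\<omega>. X \<omega> ^ 4) = 3"
proof -
  show "fourth_moment X"
    unfolding fourth_moment_def
    using distributed_integrable[OF X, of "\<lambda>x. x ^ 4"] std_normal_distr[OF X] integrable_std_normal_moment[of 4]
    by simp
  show "expectation X = 0"
    using distributed_integral[OF X, of "\<lambda>x. x"] integral_std_normal_moment_odd[of 0] by simp
  show "expectation (\<lambda>\<omega>. (X \<omega>)\<^sup>2) = 1"
    using distributed_integral[OF X, of "\<lambda>x. x\<^sup>2"] integral_std_normal_moment_even[of 1] by simp
  show "expectation (\<lambda>\<omega>. X \<omega> ^ 4) = 3"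
    using distributed_integral[OF X, of "\<lambda>x. x ^ 4"] integral_std_normal_moment_even[of 2]
    by (simp add: fact_numeral)
qed

text \<open>The layer-cake formula: U is the length of the interval from 0 to U, and Tonelli
  exchanges the two integrals.\<close>

lemma nn_integral_eq_tail_integral:
  assumes [measurable]: "U \<in> borel_measurable M" and "\<And>\<omega>. 0 \<le> U \<omega>"
  shows "(\<integral>\<^sup>+\<omega>. ennreal (U \<omega>) \<partial>M) = (\<integral>\<^sup>+s. ennreal (prob {\<omega> \<in> space M. s < U \<omega>}) * indicator {0<..} s \<partial>lborel)"
proof -
  interpret pair_sigma_finite lborel M ..
  have "(\<integral>\<^sup>+\<omega>. ennreal (U \<omega>) \<partial>M) = (\<integral>\<^sup>+\<omega>. (\<integral>\<^sup>+s. indicator {0<..<U \<omega>} s \<partial>lborel) \<partial>M)"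
    using assms by simp
  also have "\<dots> = (\<integral>\<^sup>+\<omega>. (\<integral>\<^sup>+s. (if 0 < s \<and> s < U \<omega> then 1 else 0) \<partial>lborel) \<partial>M)"
    by (intro nn_integral_cong) (auto simp: indicator_def)
  also have "\<dots> = (\<integral>\<^sup>+s. (\<integral>\<^sup>+\<omega>. (if 0 < s \<and> s < U \<omega> then 1 else 0) \<partial>M) \<partial>lborel)"
    by (rule Fubini') measurable
  also have "\<dots> = (\<integral>\<^sup>+s. ennreal (prob {\<omega> \<in> space M. s < U \<omega>}) * indicator {0<..} s \<partial>lborel)"
  proof (rule nn_integral_cong)
    fix s :: real
    have "(\<integral>\<^sup>+\<omega>. (if 0 < s \<and> s < U \<omega> then 1 else 0) \<partial>M)
        = (\<integral>\<^sup>+\<omega>. indicator {\<omega> \<in> space M. s < U \<omega>} \<omega> * indicator {0<..} s \<partial>M)"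
      by (intro nn_integral_cong) (auto simp: indicator_def)
    also have "\<dots> = ennreal (prob {\<omega> \<in> space M. s < U \<omega>}) * indicator {0<..} s"
      by (subst nn_integral_multc) (auto simp: emeasure_eq_measure)
    finally show "(\<integral>\<^sup>+\<omega>. (if 0 < s \<and> s < U \<omega> then 1 else 0) \<partial>M)
        = ennreal (prob {\<omega> \<in> space M. s < U \<omega>}) * indicator {0<..} s" .
  qed
  finally show ?thesis .
qed

context
  fixes X :: "nat \<Rightarrow> 'a \<Rightarrow> real" and lam :: nat
  assumes lam: "1 \<le> lam"
    and normal: "\<And>i. i < lam \<Longrightarrow> distributed M lborel (X i) (\<lambda>x. ennreal (std_normal_density x))"
    and indep: "indep_vars (\<lambda>_. borel) X {..<lam}"
begin

lemma Min_measurable: "1 \<le> k \<Longrightarrow> k \<le> lam \<Longrightarrow> (\<lambda>\<omega>. MIN i\<in>{..<k}. X i \<omega>) \<in> borel_measurable M"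
  by (rule borel_measurable_Min) (auto intro: std_normal_distr(1)[OF normal])

text \<open>The minimum exceeds a level exactly when all variables do, so both events on its sign
  reduce to powers of a one-variable probability. Every prefix length \<open>k\<close> is covered in
  order to compare a single variable with all \<open>lam\<close> of them on the same space.\<close>

lemma prob_Min_square_greater:
  assumes k: "1 \<le> k" "k \<le> lam" and "0 \<le> s"
  shows "prob {\<omega> \<in> space M. s < (MIN i\<in>{..<k}. X i \<omega>)\<^sup>2}
    = 1 + measure std_normal {sqrt s<..} ^ k - (1 - measure std_normal {sqrt s<..}) ^ k"
proof -
  define a where "a = sqrt s"
  have a: "0 \<le> a" "s = a\<^sup>2" using \<open>0 \<le> s\<close> by (simp_all add: a_def)
  let ?m = "\<lambda>\<omega>. MIN i\<in>{..<k}. X i \<omega>"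
  note [measurable] = Min_measurable[OF k]
  have ne: "{..<k} \<noteq> {}" using k by (auto simp: lessThan_empty_iff)
  have indep': "indep_vars (\<lambda>_. borel) X {..<k}" by (rule indep_vars_subset[OF indep]) (use k in auto)
  have all: "prob (\<Inter>i\<in>{..<k}. X i -` A \<inter> space M) = measure std_normal A ^ k"
    if "A \<in> sets borel" for A
    using indep_varsD_finite[OF indep' ne, of "\<lambda>_. A"] that k by (simp add: std_normal_prob[OF normal])
  have "{\<omega> \<in> space M. a < ?m \<omega>} = (\<Inter>i\<in>{..<k}. X i -` {a<..} \<inter> space M)"
    using ne by (auto simp: Min_gr_iff)
  then have up: "prob {\<omega> \<in> space M. a < ?m \<omega>} = measure std_normal {a<..} ^ k" by (simp only: all greaterThan_borel)
  have "{\<omega> \<in> space M. -a \<le> ?m \<omega>} = (\<Inter>i\<in>{..<k}. X i -` {-a..} \<inter> space M)"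
    using ne by (auto simp: Min_ge_iff)
  then have "prob {\<omega> \<in> space M. -a \<le> ?m \<omega>} = (1 - measure std_normal {a<..}) ^ k"
    by (simp only: all atLeast_borel std_normal_atLeast)
  moreover have "{\<omega> \<in> space M. ?m \<omega> < -a} = space M - {\<omega> \<in> space M. -a \<le> ?m \<omega>}" by auto
  ultimately have low: "prob {\<omega> \<in> space M. ?m \<omega> < -a} = 1 - (1 - measure std_normal {a<..}) ^ k"
    by (simp add: prob_compl)
  have "a\<^sup>2 < x\<^sup>2 \<longleftrightarrow> a < x \<or> x < -a" for x :: real
    using abs_le_square_iff[of x a] a by (auto simp flip: not_le)
  then have "{\<omega> \<in> space M. s < (?m \<omega>)\<^sup>2} = {\<omega> \<in> space M. a < ?m \<omega>} \<union> {\<omega> \<in> space M. ?m \<omega> < -a}"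
    using a by auto
  then have "prob {\<omega> \<in> space M. s < (?m \<omega>)\<^sup>2} = prob {\<omega> \<in> space M. a < ?m \<omega>} + prob {\<omega> \<in> space M. ?m \<omega> < -a}"
    using a by (auto intro!: finite_measure_Union)
  then show ?thesis unfolding up low by (simp add: a_def)
qed

lemma distr_restrict_std_normal_vec:
  "distr M (PiM {..<lam} (\<lambda>_. borel)) (\<lambda>\<omega>. \<lambda>i\<in>{..<lam}. X i \<omega>) = std_normal_vec lam"
proof -
  have "distr M (PiM {..<lam} (\<lambda>_. borel)) (\<lambda>\<omega>. \<lambda>i\<in>{..<lam}. X i \<omega>)
      = PiM {..<lam} (\<lambda>i. distr M borel (X i))"
    using indep lam by (subst (asm) indep_vars_iff_distr_eq_PiM') (auto simp: lessThan_empty_iff intro: std_normal_distr(1)[OF normal])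
  also have "\<dots> = std_normal_vec lam"
    unfolding std_normal_vec_def by (intro PiM_cong) (auto simp: std_normal_distr(2)[OF normal])
  finally show ?thesis .
qed

text \<open>The two constants are integrals over a product measure, which is the joint law of any
  independent family of standard normals; the integrals are transported along that law.\<close>

lemma mean_min_normal_eq: "mean_min_normal lam = expectation (\<lambda>\<omega>. MIN i\<in>{..<lam}. X i \<omega>)"
  and mean_sq_min_normal_eq: "mean_sq_min_normal lam = expectation (\<lambda>\<omega>. (MIN i\<in>{..<lam}. X i \<omega>)\<^sup>2)"
proof -
  have m: "(\<lambda>\<omega>. \<lambda>i\<in>{..<lam}. X i \<omega>) \<in> measurable M (PiM {..<lam} (\<lambda>_. borel))"
    by (auto intro!: measurable_restrict std_normal_distr(1)[OF normal])
  have Min: "(\<lambda>x::nat \<Rightarrow> real. Min (x ` {..<lam})) \<in> borel_measurable (PiM {..<lam} (\<lambda>_. borel))"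
    by (rule borel_measurable_Min[where f = "\<lambda>i x. x i"]) auto
  then have Min2: "(\<lambda>x::nat \<Rightarrow> real. (Min (x ` {..<lam}))\<^sup>2) \<in> borel_measurable (PiM {..<lam} (\<lambda>_. borel))"
    by simp
  have eq: "(\<lambda>i\<in>{..<lam}. X i \<omega>) ` {..<lam} = (\<lambda>i. X i \<omega>) ` {..<lam}" for \<omega> by auto
  show "mean_min_normal lam = expectation (\<lambda>\<omega>. MIN i\<in>{..<lam}. X i \<omega>)"
    unfolding mean_min_normal_def distr_restrict_std_normal_vec[symmetric]
    by (simp only: integral_distr[OF m Min] eq)
  show "mean_sq_min_normal lam = expectation (\<lambda>\<omega>. (MIN i\<in>{..<lam}. X i \<omega>)\<^sup>2)"
    unfolding mean_sq_min_normal_def distr_restrict_std_normal_vec[symmetric]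
    by (simp only: integral_distr[OF m Min2] eq)
qed

lemma Min_in_X: "\<exists>i<lam. (MIN i\<in>{..<lam}. X i \<omega>) = X i \<omega>"
proof -
  have "(MIN i\<in>{..<lam}. X i \<omega>) \<in> (\<lambda>i. X i \<omega>) ` {..<lam}"
    by (rule Min_in) (use lam in \<open>auto simp: lessThan_empty_iff\<close>)
  then show ?thesis by auto
qed

lemma fourth_moment_Min: "fourth_moment (\<lambda>\<omega>. MIN i\<in>{..<lam}. X i \<omega>)"
proof (rule fourth_moment_bound[OF Min_measurable])
  show "integrable M (\<lambda>\<omega>. \<Sum>i<lam. X i \<omega> ^ 4)"
    using std_normal_moments(1)[OF normal] by (auto simp: fourth_moment_integrable)
  fix \<omega>
  obtain i where "i < lam" "(MIN i\<in>{..<lam}. X i \<omega>) = X i \<omega>" using Min_in_X by blast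
  then show "(MIN i\<in>{..<lam}. X i \<omega>) ^ 4 \<le> (\<Sum>i<lam. X i \<omega> ^ 4)"
    by (auto intro!: member_le_sum zero_le_even_power)
qed (use lam in auto)

text \<open>By the layer-cake formula both second moments are integrals of tails that can be
  compared at each level; the tail for one variable integrates to its variance 1. Strictness at all
  positive levels is turned into strictness of the integrals through the interval from 0 to 1, which
  is not a null set.\<close>

lemma mean_sq_min_normal_ge_1: "1 \<le> mean_sq_min_normal lam"
  and mean_sq_min_normal_greater_1: "3 \<le> lam \<Longrightarrow> 1 < mean_sq_min_normal lam"
proof -
  define Q where "Q s = measure std_normal {sqrt s<..}" for s
  have [measurable]: "Q \<in> borel_measurable borel" unfolding Q_def by (rule measurable_std_normal_upper_tail)
  have Q: "0 < Q s" "Q s < 1 / 2" if "0 < s" for s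
    unfolding Q_def using std_normal_upper_tail[of "sqrt s"] that by simp_all
  define T where "T k s = ennreal (1 + Q s ^ k - (1 - Q s) ^ k) * indicator {0<..} s" for k s
  have [measurable]: "T k \<in> borel_measurable lborel" for k unfolding T_def by simp
  have cake: "(\<integral>\<^sup>+\<omega>. ennreal ((MIN i\<in>{..<k}. X i \<omega>)\<^sup>2) \<partial>M) = (\<integral>\<^sup>+s. T k s \<partial>lborel)"
    if k: "1 \<le> k" "k \<le> lam" for k
    using Min_measurable[OF k]
    by (subst nn_integral_eq_tail_integral)
      (auto intro!: nn_integral_cong simp: T_def Q_def prob_Min_square_greater[OF k] indicator_def)
  have "(\<integral>\<^sup>+s. T 1 s \<partial>lborel) = (\<integral>\<^sup>+\<omega>. ennreal ((X 0 \<omega>)\<^sup>2) \<partial>M)"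
    using cake[of 1] lam by (simp add: lessThan_Suc)
  also have "\<dots> = 1"
    using std_normal_moments[OF normal, of 0] lam
    by (subst nn_integral_eq_integral) (auto intro: fourth_moment_integrable_square)
  finally have one: "(\<integral>\<^sup>+s. T 1 s \<partial>lborel) = 1" .
  have sq: "(\<integral>\<^sup>+s. T lam s \<partial>lborel) = ennreal (mean_sq_min_normal lam)"
    unfolding cake[OF lam order_refl, symmetric] mean_sq_min_normal_eq
    using fourth_moment_integrable_square[OF fourth_moment_Min]
    by (rule nn_integral_eq_integral) simp
  have T1: "T 1 s = ennreal (2 * Q s) * indicator {0<..} s" for s by (simp add: T_def)
  have le: "T 1 s \<le> T lam s" for s
    using two_sided_tail_ge[of "Q s" lam] Q[of s] lam unfolding T1
    by (auto simp: T_def indicator_def intro!: ennreal_leI)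
  then have "(\<integral>\<^sup>+s. T 1 s \<partial>lborel) \<le> (\<integral>\<^sup>+s. T lam s \<partial>lborel)" by (intro nn_integral_mono) simp
  moreover have nonneg: "0 \<le> mean_sq_min_normal lam" by (simp add: mean_sq_min_normal_eq)
  ultimately show "1 \<le> mean_sq_min_normal lam" unfolding one sq by (simp flip: ennreal_1)
  assume "3 \<le> lam"
  then have less: "T 1 s < T lam s" if "0 < s" for s
    using two_sided_tail_greater[of "Q s" lam] Q[of s] that unfolding T1
    by (auto simp: T_def indicator_def intro!: ennreal_lessI)
  have "(\<integral>\<^sup>+s. T 1 s \<partial>lborel) < (\<integral>\<^sup>+s. T lam s \<partial>lborel)"
  proof (rule nn_integral_less)
    show "\<not> (AE s in lborel. T lam s \<le> T 1 s)"
    proof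
      assume "AE s in lborel. T lam s \<le> T 1 s"
      then have "AE s in lborel. s \<notin> {0<..<1::real}"
        by eventually_elim (use less in \<open>auto simp: not_le[symmetric]\<close>)
      then have "emeasure lborel {0<..<1::real} = 0"
        by (subst (asm) AE_iff_measurable[OF _ refl]) (auto simp: Collect_interval)
      then show False by simp
    qed
  qed (use one le in auto)
  then show "1 < mean_sq_min_normal lam" unfolding one sq by (simp flip: ennreal_1 add: ennreal_less_iff)
qed

text \<open>If the minimum of two variables had mean zero, it would agree almost surely with each of them,
  although their difference has variance 2.\<close>
lemma mean_min_normal_2_nonzero:
  assumes "lam = 2"
  shows "mean_min_normal lam \<noteq> 0"
proof
  assume 0: "mean_min_normal lam = 0"
  let ?m = "\<lambda>\<omega>. MIN i\<in>{..<lam}. X i \<omega>"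
  have int: "integrable M ?m" by (rule fourth_moment_integrable_self[OF fourth_moment_Min])
  have eq: "AE \<omega> in M. X i \<omega> - ?m \<omega> = 0" if i: "i < lam" for i
  proof -
    have Xi: "integrable M (X i)" by (rule fourth_moment_integrable_self[OF std_normal_moments(1)[OF normal[OF i]]])
    have "expectation (\<lambda>\<omega>. X i \<omega> - ?m \<omega>) = 0"
      using 0 int Xi by (simp add: std_normal_moments(2)[OF normal[OF i]] mean_min_normal_eq)
    moreover have "0 \<le> X i \<omega> - ?m \<omega>" for \<omega> using i by simp
    ultimately show ?thesis
      using int Xi by (subst (asm) integral_nonneg_eq_0_iff_AE) auto
  qed
  have "AE \<omega> in M. (X 0 \<omega> - X 1 \<omega>)\<^sup>2 = 0"
    using eq[of 0] eq[of 1] assms by auto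
  then have "expectation (\<lambda>\<omega>. (X 0 \<omega> - X 1 \<omega>)\<^sup>2) = expectation (\<lambda>_. 0)"
    using std_normal_distr(1)[OF normal] assms by (intro integral_cong_AE) auto
  then have zero: "expectation (\<lambda>\<omega>. (X 0 \<omega> - X 1 \<omega>)\<^sup>2) = 0" by simp
  note f = std_normal_moments(1)[OF normal]
  have "expectation (\<lambda>\<omega>. \<Prod>i\<in>{..<lam}. X i \<omega>) = (\<Prod>i\<in>{..<lam}. expectation (X i))"
    using fourth_moment_integrable_self[OF f] indep by (intro indep_vars_lebesgue_integral) auto
  then have cross: "expectation (\<lambda>\<omega>. X 0 \<omega> * X 1 \<omega>) = 0"
    using std_normal_moments(2)[OF normal] assms by (simp add: numeral_2_eq_2 lessThan_Suc mult.commute)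
  have "integrable M (\<lambda>\<omega>. X 0 \<omega> * X 1 \<omega>)"
    using fourth_moment_integrable_product[OF f f fourth_moment_const[of 1] fourth_moment_const[of 1], of 0 1] assms
    by simp
  moreover have "(X 0 \<omega> - X 1 \<omega>)\<^sup>2 = (X 0 \<omega>)\<^sup>2 + (X 1 \<omega>)\<^sup>2 - 2 * (X 0 \<omega> * X 1 \<omega>)" for \<omega>
    by (simp add: power2_diff)
  ultimately have "expectation (\<lambda>\<omega>. (X 0 \<omega> - X 1 \<omega>)\<^sup>2) = 2"
    using fourth_moment_integrable_square[OF f, of 0] fourth_moment_integrable_square[OF f, of 1]
      cross std_normal_moments(3)[OF normal] assms by simp
  with zero show False by simp
qed

end

end

section \<open>The selected step\<close>

text \<open>Ties are broken as in \<open>csa_select\<close>, so the two agree at every outcome and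
  no null event has to be excluded.\<close>

definition first_argmin :: "nat \<Rightarrow> (nat \<Rightarrow> real) \<Rightarrow> nat" where
  "first_argmin lam g = (LEAST i. i < lam \<and> (\<forall>k<lam. g i \<le> g k))"

lemma first_argmin:
  assumes "1 \<le> lam"
  shows "first_argmin lam g < lam" "k < lam \<Longrightarrow> g (first_argmin lam g) \<le> g k"
proof -
  have "Min (g ` {..<lam}) \<in> g ` {..<lam}"
    using assms by (intro Min_in) (auto simp: lessThan_empty_iff)
  then obtain i where i: "i < lam" "g i = Min (g ` {..<lam})" by auto
  then have "i < lam \<and> (\<forall>k<lam. g i \<le> g k)" by simp
  then have "first_argmin lam g < lam \<and> (\<forall>k<lam. g (first_argmin lam g) \<le> g k)"
    unfolding first_argmin_def by (rule LeastI)
  then show "first_argmin lam g < lam" "k < lam \<Longrightarrow> g (first_argmin lam g) \<le> g k" by auto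
qed

lemma first_argmin_value:
  assumes "1 \<le> lam"
  shows "g (first_argmin lam g) = (MIN i\<in>{..<lam}. g i)"
  using first_argmin[OF assms] by (intro Min_eqI[symmetric]) auto

lemma first_argmin_cong:
  assumes "\<And>i. i < lam \<Longrightarrow> g i = h i"
  shows "first_argmin lam g = first_argmin lam h"
proof -
  have "(\<lambda>i. i < lam \<and> (\<forall>k<lam. g i \<le> g k)) = (\<lambda>i. i < lam \<and> (\<forall>k<lam. h i \<le> h k))"
    using assms by auto
  then show ?thesis by (simp add: first_argmin_def)
qed

text \<open>Adding the parent and scaling by a positive step-size preserve the order of the first
  coordinates. Selection thus ignores the state, which makes the selected steps independent over
  time.\<close>

lemma csa_select_first_coordinate:
  "0 < \<sigma> \<Longrightarrow> csa_select lam (\<lambda>x. x 0) X \<sigma> xs = first_argmin lam (\<lambda>i. xs i 0)"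
  by (simp add: csa_select_def first_argmin_def)

lemma measurable_first_argmin:
  assumes "\<And>i. i < lam \<Longrightarrow> X i \<in> borel_measurable N"
  shows "(\<lambda>\<omega>. first_argmin lam (\<lambda>i. X i \<omega>)) \<in> measurable N (count_space UNIV)"
  unfolding first_argmin_def
proof (rule measurable_Least)
  fix i
  show "Measurable.pred N (\<lambda>\<omega>. i < lam \<and> (\<forall>k<lam. X i \<omega> \<le> X k \<omega>))"
  proof (cases "i < lam")
    case True
    have "{\<omega> \<in> space N. X i \<omega> \<le> X k \<omega>} \<in> sets N" if "k \<in> {..<lam}" for k
      by (rule borel_measurable_le) (use assms True that in auto)
    then have "{\<omega> \<in> space N. \<forall>k\<in>{..<lam}. X i \<omega> \<le> X k \<omega>} \<in> sets N"
      by (rule sets.sets_Collect_finite_All) simp_all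
    also have "{\<omega> \<in> space N. \<forall>k\<in>{..<lam}. X i \<omega> \<le> X k \<omega>}
        = {\<omega> \<in> space N. i < lam \<and> (\<forall>k<lam. X i \<omega> \<le> X k \<omega>)}"
      using True by auto
    finally show ?thesis unfolding pred_def .
  next
    case False
    then show ?thesis by simp
  qed
qed

text \<open>Evaluation at a random index becomes a finite sum of indicators times fixed variables,
  the form in which measurability and independence can be used.\<close>

lemma sum_first_argmin:
  fixes f :: "nat \<Rightarrow> real"
  assumes "1 \<le> lam"
  shows "f (first_argmin lam g) = (\<Sum>i<lam. (if first_argmin lam g = i then 1 else 0) * f i)"
proof -
  have "(\<Sum>i<lam. (if first_argmin lam g = i then 1 else 0) * f i)
      = (\<Sum>i<lam. if first_argmin lam g = i then f i else 0)"
    by (intro sum.cong) simp_all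
  also have "\<dots> = f (first_argmin lam g)"
    using first_argmin(1)[OF assms, of g] by (subst sum.delta') simp_all
  finally show ?thesis by (rule sym)
qed

lemma measurable_selected:
  assumes "1 \<le> lam" "\<And>i. i < lam \<Longrightarrow> X i \<in> borel_measurable N" "\<And>i. i < lam \<Longrightarrow> Y i \<in> borel_measurable N"
  shows "(\<lambda>\<omega>. Y (first_argmin lam (\<lambda>i. X i \<omega>)) \<omega> :: real) \<in> borel_measurable N"
proof -
  have ind: "(\<lambda>\<omega>. if first_argmin lam (\<lambda>i. X i \<omega>) = i then 1 else 0 :: real) \<in> borel_measurable N" for i
    by (rule measurable_compose[OF measurable_first_argmin[where X = X and N = N, OF assms(2)],
          where g = "\<lambda>s. if s = i then 1 else 0 :: real"]) simp_all
  have "(\<lambda>\<omega>. \<Sum>i<lam. (if first_argmin lam (\<lambda>i. X i \<omega>) = i then 1 else 0) * Y i \<omega>) \<in> borel_measurable N"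
    by (rule borel_measurable_sum) (rule borel_measurable_times[OF ind assms(3)], simp)
  moreover have "(\<lambda>\<omega>. Y (first_argmin lam (\<lambda>i. X i \<omega>)) \<omega>)
      = (\<lambda>\<omega>. \<Sum>i<lam. (if first_argmin lam (\<lambda>i. X i \<omega>) = i then 1 else 0) * Y i \<omega>)"
    by (rule ext) (rule sum_first_argmin[OF assms(1)])
  ultimately show ?thesis by (simp only:)
qed

section \<open>Moments of the selected step\<close>

context prob_space begin

context
  fixes F :: "nat \<times> nat \<Rightarrow> 'a \<Rightarrow> real" and lam n :: nat
  assumes lam: "1 \<le> lam" and n: "1 \<le> n"
    and normal: "\<And>i j. i < lam \<Longrightarrow> j < n \<Longrightarrow> distributed M lborel (F (i, j)) (\<lambda>x. ennreal (std_normal_density x))"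
    and indep: "indep_vars (\<lambda>_. borel) F ({..<lam} \<times> {..<n})"
begin

abbreviation selected_step :: "nat \<Rightarrow> 'a \<Rightarrow> real" where
  "selected_step j \<omega> \<equiv> F (first_argmin lam (\<lambda>i. F (i, 0) \<omega>), j) \<omega>"

lemma selected_step_measurable: "j < n \<Longrightarrow> selected_step j \<in> borel_measurable M"
  using n by (intro measurable_selected[where Y = "\<lambda>i. F (i, j)"] lam std_normal_distr(1)[OF normal]) auto

lemma selected_step_fourth_power_le: "selected_step j \<omega> ^ 4 \<le> (\<Sum>i<lam. F (i, j) \<omega> ^ 4)"
  using first_argmin(1)[OF lam]
  by (intro member_le_sum[where f = "\<lambda>i. F (i, j) \<omega> ^ 4"]) (auto simp: zero_le_even_power)

text \<open>The selected value is one of \<open>lam\<close> normal variables with fourth moment 3.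
  Summing over all candidates is crude, but a bound uniform in time is enough.\<close>

lemma selected_step_fourth_moment:
  assumes "j < n"
  shows "fourth_moment (selected_step j)" "expectation (\<lambda>\<omega>. selected_step j \<omega> ^ 4) \<le> 3 * lam"
proof -
  have int: "integrable M (\<lambda>\<omega>. \<Sum>i<lam. F (i, j) \<omega> ^ 4)"
    using std_normal_moments(1)[OF normal] assms by (auto simp: fourth_moment_integrable)
  show f: "fourth_moment (selected_step j)"
    by (rule fourth_moment_bound[OF selected_step_measurable[OF assms] int selected_step_fourth_power_le])
  have "expectation (\<lambda>\<omega>. selected_step j \<omega> ^ 4) \<le> expectation (\<lambda>\<omega>. \<Sum>i<lam. F (i, j) \<omega> ^ 4)"
    by (intro integral_mono fourth_moment_integrable f int selected_step_fourth_power_le)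
  also have "\<dots> = (\<Sum>i<lam. expectation (\<lambda>\<omega>. F (i, j) \<omega> ^ 4))"
    using std_normal_moments(1)[OF normal] assms
    by (intro Bochner_Integration.integral_sum) (auto simp: fourth_moment_integrable)
  also have "\<dots> = 3 * lam" using std_normal_moments(4)[OF normal] assms by simp
  finally show "expectation (\<lambda>\<omega>. selected_step j \<omega> ^ 4) \<le> 3 * lam" by simp
qed

text \<open>Selection only looks at coordinate 0, hence the selected index is independent of the
  other coordinates.\<close>
lemma expectation_selected_step_unselected:
  fixes h :: "real \<Rightarrow> real"
  assumes j: "1 \<le> j" "j < n" and h: "h \<in> borel_measurable borel"
    and int: "\<And>i. i < lam \<Longrightarrow> integrable M (\<lambda>\<omega>. h (F (i, j) \<omega>))"
    and e: "\<And>i. i < lam \<Longrightarrow> expectation (\<lambda>\<omega>. h (F (i, j) \<omega>)) = e"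
  shows "expectation (\<lambda>\<omega>. h (selected_step j \<omega>)) = e"
proof -
  let ?s = "\<lambda>\<omega>. first_argmin lam (\<lambda>i. F (i, 0) \<omega>)"
  define I where "I i \<omega> = (if ?s \<omega> = i then 1 else 0 :: real)" for i \<omega>
  have [measurable]: "?s \<in> measurable M (count_space UNIV)"
    using n by (intro measurable_first_argmin std_normal_distr(1)[OF normal]) auto
  have Im: "I i \<in> borel_measurable M" for i unfolding I_def by measurable
  have Iint: "integrable M (I i)" for i
    by (rule integrable_const_bound[of _ 1]) (use Im in \<open>auto simp: I_def\<close>)
  have prod: "integrable M (\<lambda>\<omega>. I i \<omega> * h (F (i, j) \<omega>))"
    "expectation (\<lambda>\<omega>. I i \<omega> * h (F (i, j) \<omega>)) = expectation (I i) * e" if i: "i < lam" for i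
  proof -
    let ?A = "{..<lam} \<times> {0::nat}" and ?B = "{(i, j)}"
    have AB: "indep_var (PiM ?A (\<lambda>_. borel)) (\<lambda>\<omega>. restrict (\<lambda>k. F k \<omega>) ?A)
        (PiM ?B (\<lambda>_. borel)) (\<lambda>\<omega>. restrict (\<lambda>k. F k \<omega>) ?B)"
      by (rule indep_var_restrict[OF indep]) (use i j n in auto)
    have [measurable]: "(\<lambda>f. first_argmin lam (\<lambda>k. f (k, 0))) \<in> measurable (PiM ?A (\<lambda>_. borel)) (count_space UNIV)"
      by (rule measurable_first_argmin) auto
    have s: "first_argmin lam (\<lambda>k. restrict (\<lambda>k. F k \<omega>) ?A (k, 0)) = ?s \<omega>" for \<omega>
      by (rule first_argmin_cong) auto
    have Y1: "(\<lambda>f. if first_argmin lam (\<lambda>k. f (k, 0)) = i then 1 else 0 :: real)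
        \<in> borel_measurable (PiM ?A (\<lambda>_. borel))"
      by measurable
    have Y2: "(\<lambda>f. h (f (i, j))) \<in> borel_measurable (PiM ?B (\<lambda>_. borel))"
      using h by measurable
    have "(\<lambda>f. if first_argmin lam (\<lambda>k. f (k, 0)) = i then 1 else 0 :: real) \<circ> (\<lambda>\<omega>. restrict (\<lambda>k. F k \<omega>) ?A) = I i"
      by (rule ext) (simp only: comp_def s I_def)
    moreover have "(\<lambda>f. h (f (i, j))) \<circ> (\<lambda>\<omega>. restrict (\<lambda>k. F k \<omega>) ?B) = (\<lambda>\<omega>. h (F (i, j) \<omega>))"
      by (simp add: comp_def)
    ultimately have "indep_var borel (I i) borel (\<lambda>\<omega>. h (F (i, j) \<omega>))"
      using indep_var_compose[OF AB Y1 Y2] by (simp only:)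
    from indep_var_integrable[OF this Iint int[OF i]] indep_var_lebesgue_integral[OF this Iint int[OF i]]
    show "integrable M (\<lambda>\<omega>. I i \<omega> * h (F (i, j) \<omega>))"
      "expectation (\<lambda>\<omega>. I i \<omega> * h (F (i, j) \<omega>)) = expectation (I i) * e"
      using e[OF i] by auto
  qed
  have "h (selected_step j \<omega>) = (\<Sum>i<lam. I i \<omega> * h (F (i, j) \<omega>))" for \<omega>
    unfolding I_def by (rule sum_first_argmin[OF lam])
  then have "expectation (\<lambda>\<omega>. h (selected_step j \<omega>)) = (\<Sum>i<lam. expectation (I i) * e)"
    using prod by (simp add: Bochner_Integration.integral_sum)
  also have "\<dots> = expectation (\<lambda>\<omega>. \<Sum>i<lam. I i \<omega>) * e"
    using Iint by (simp add: Bochner_Integration.integral_sum sum_distrib_right)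
  also have "(\<lambda>\<omega>. \<Sum>i<lam. I i \<omega>) = (\<lambda>\<omega>. 1)"
    by (rule ext) (simp add: I_def first_argmin(1)[OF lam])
  finally show ?thesis by (simp add: prob_space)
qed

lemma selected_step_moments_unselected:
  assumes "1 \<le> j" "j < n"
  shows "expectation (selected_step j) = 0" "expectation (\<lambda>\<omega>. (selected_step j \<omega>)\<^sup>2) = 1"
proof -
  note std = std_normal_moments[OF normal[OF _ assms(2)]]
  show "expectation (selected_step j) = 0"
    by (rule expectation_selected_step_unselected[OF assms, of "\<lambda>x. x"])
      (simp_all add: std(2) fourth_moment_integrable_self[OF std(1)])
  show "expectation (\<lambda>\<omega>. (selected_step j \<omega>)\<^sup>2) = 1"
    by (rule expectation_selected_step_unselected[OF assms, of "\<lambda>x. x\<^sup>2"])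
      (simp_all add: std(3) fourth_moment_integrable_square[OF std(1)])
qed

lemma first_coordinate_indep: "indep_vars (\<lambda>_. borel) (\<lambda>i. F (i, 0)) {..<lam}"
proof -
  have "indep_vars (\<lambda>i. PiM {(i, 0)} (\<lambda>_. borel)) (\<lambda>i \<omega>. restrict (\<lambda>k. F k \<omega>) {(i, 0)}) {..<lam}"
    by (rule indep_vars_restrict[OF indep]) (use n in \<open>auto simp: disjoint_family_on_def\<close>)
  from indep_vars_compose2[OF this, of "\<lambda>i f. f (i, 0)" "\<lambda>_. borel"] show ?thesis by simp
qed

lemma selected_step_moments_first:
  shows "expectation (selected_step 0) = mean_min_normal lam"
    and "expectation (\<lambda>\<omega>. (selected_step 0 \<omega>)\<^sup>2) = mean_sq_min_normal lam"
proof -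
  have eq: "selected_step 0 \<omega> = (MIN i\<in>{..<lam}. F (i, 0) \<omega>)" for \<omega>
    by (rule first_argmin_value[OF lam])
  have "0 < n" using n by simp
  note first = lam normal[OF _ this] first_coordinate_indep
  show "expectation (selected_step 0) = mean_min_normal lam"
    unfolding eq by (rule mean_min_normal_eq[OF first, symmetric])
  show "expectation (\<lambda>\<omega>. (selected_step 0 \<omega>)\<^sup>2) = mean_sq_min_normal lam"
    unfolding eq by (rule mean_sq_min_normal_eq[OF first, symmetric])
qed

end

end

section \<open>The step-size\<close>

text \<open>The input sequence of \<open>cumulation\<close> for coordinate \<open>j\<close>: the
  initial path at index 0, then the steps selected at times 0, 1, and so on.\<close>

definition selected_coordinate ::
  "nat \<Rightarrow> (nat \<Rightarrow> real) \<Rightarrow> (nat \<Rightarrow> nat \<Rightarrow> nat \<Rightarrow> real) \<Rightarrow> nat \<Rightarrow> nat \<Rightarrow> real" where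
  "selected_coordinate lam p0 xi j =
    case_nat (p0 j) (\<lambda>t. xi t (first_argmin lam (\<lambda>i. xi t i 0)) j)"

text \<open>Positivity belongs to the induction because selection reduces to
  \<open>first_argmin\<close> only for a positive step-size. The logarithm turns the multiplicative
  updates into the sum of squared paths.\<close>

lemma csa_state_cumulation:
  fixes c d_\<sigma> :: real and n lam :: nat and X0 p0 :: "nat \<Rightarrow> real" and xi :: "nat \<Rightarrow> nat \<Rightarrow> nat \<Rightarrow> real"
  assumes "0 < \<sigma>0"
  defines "st \<equiv> csa_state n lam c d_\<sigma> (\<lambda>x. x 0) X0 \<sigma>0 p0 xi"
    and "p \<equiv> \<lambda>t j. cumulation c (selected_coordinate lam p0 xi j) t"
  shows "0 < fst (snd (st t)) \<and> snd (snd (st t)) = p t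
    \<and> ln (fst (snd (st t)) / \<sigma>0) = c / (2 * d_\<sigma>) * ((\<Sum>j<n. \<Sum>s<t. (p (Suc s) j)\<^sup>2) / n - t)"
proof (induction t)
  case 0
  then show ?case
    using assms(1) by (simp add: st_def p_def selected_coordinate_def fun_eq_iff)
next
  case (Suc t)
  obtain X \<sigma> q where st: "st t = (X, \<sigma>, q)" by (cases "st t") auto
  have \<sigma>: "0 < \<sigma>" and q: "q = p t"
    and ln: "ln (\<sigma> / \<sigma>0) = c / (2 * d_\<sigma>) * ((\<Sum>j<n. \<Sum>s<t. (p (Suc s) j)\<^sup>2) / n - t)"
    using Suc by (auto simp: st)
  have p: "p (Suc t) = (\<lambda>j. (1 - c) * q j + sqrt (c * (2 - c)) * xi t (first_argmin lam (\<lambda>i. xi t i 0)) j)"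
    by (simp add: p_def q selected_coordinate_def)
  have *: "snd (st (Suc t)) = (\<sigma> * exp (c / (2 * d_\<sigma>) * (sqnorm n (p (Suc t)) / n - 1)), p (Suc t))"
    using st \<sigma> by (simp add: st_def p Let_def csa_select_first_coordinate)
  define a where "a = c / (2 * d_\<sigma>)"
  have "ln (\<sigma> * exp (c / (2 * d_\<sigma>) * (sqnorm n (p (Suc t)) / n - 1)) / \<sigma>0)
      = ln (\<sigma> / \<sigma>0) + c / (2 * d_\<sigma>) * (sqnorm n (p (Suc t)) / n - 1)"
    using \<sigma> assms(1) by (simp add: ln_mult ln_div)
  also have "\<dots> = c / (2 * d_\<sigma>) * ((\<Sum>j<n. \<Sum>s<Suc t. (p (Suc s) j)\<^sup>2) / n - Suc t)"
    unfolding ln sqnorm_def a_def[symmetric] by (simp add: sum.distrib add_divide_distrib algebra_simps)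
  finally show ?case using \<sigma> unfolding * by simp
qed

theorem theorem3:
  fixes M :: "'a measure" and n lam :: nat and c d_\<sigma> \<sigma>0 :: real
    and X0 :: "nat \<Rightarrow> real"
    and P0 :: "nat \<Rightarrow> 'a \<Rightarrow> real" and Xi :: "nat \<Rightarrow> nat \<Rightarrow> nat \<Rightarrow> 'a \<Rightarrow> real"
  defines "Z \<equiv> case_sum P0 (\<lambda>(t, i, j). Xi t i j)"
    and "I \<equiv> Inl ` {..<n} \<union> Inr ` {(t, i, j). i < lam \<and> j < n}"
    and "\<sigma> \<equiv> (\<lambda>t \<omega>. csa_sigma n lam c d_\<sigma> (\<lambda>x. x 0) X0 \<sigma>0
                        (\<lambda>j. P0 j \<omega>) (\<lambda>t i j. Xi t i j \<omega>) t)"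
    and "L \<equiv> 1 / (2 * d_\<sigma> * real n) *
              (2 * (1 - c) * (mean_min_normal lam)\<^sup>2 + c * (mean_sq_min_normal lam - 1))"
  assumes "prob_space M"
    and "n \<ge> 1" and "lam \<ge> 2" and "0 < c" and "c \<le> 1" and "d_\<sigma> > 0" and "\<sigma>0 > 0"
    and "\<And>k. k \<in> I \<Longrightarrow> distributed M lborel (Z k) std_normal_density"
    and "prob_space.indep_vars M (\<lambda>_. borel) Z I"
  shows "(AE \<omega> in M. (\<lambda>t. ln (\<sigma> t \<omega> / \<sigma>0) / real t) \<longlonglongrightarrow> L)
         \<and> (\<forall>t. integrable M (\<lambda>\<omega>. ln (\<sigma> t \<omega> / \<sigma>0)))
         \<and> (\<lambda>t. prob_space.expectation M (\<lambda>\<omega>. ln (\<sigma> t \<omega> / \<sigma>0)) / real t) \<longlonglongrightarrow> L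
         \<and> (lam \<ge> 3 \<longrightarrow> L > 0)
         \<and> (lam = 2 \<and> c < 1 \<longrightarrow> L > 0)
         \<and> (lam \<ge> 3 \<or> c < 1 \<longrightarrow> (AE \<omega> in M. filterlim (\<lambda>t. \<sigma> t \<omega>) at_top sequentially))"
proof -
  interpret prob_space M by fact
  have lam: "1 \<le> lam" using \<open>lam \<ge> 2\<close> by simp
  note normal = assms(12) and indep = assms(13)
  define F where "F t = (\<lambda>(i, j). Xi t i j)" for t
  define W where "W j i \<omega> = selected_coordinate lam (\<lambda>j. P0 j \<omega>) (\<lambda>t i j. Xi t i j \<omega>) j i" for j i \<omega>
  have W0: "W j 0 = P0 j" for j by (auto simp: W_def selected_coordinate_def)
  have WSuc: "W j (Suc t) = (\<lambda>\<omega>. F t (first_argmin lam (\<lambda>i. F t (i, 0) \<omega>), j) \<omega>)" for j t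
    by (auto simp: W_def F_def selected_coordinate_def)
  have Fnormal: "distributed M lborel (F t (i, j)) std_normal_density" if "i < lam" "j < n" for t i j
    using normal[of "Inr (t, i, j)"] that by (simp add: Z_def I_def F_def)
  have P0normal: "distributed M lborel (P0 j) std_normal_density" if "j < n" for j
    using normal[of "Inl j"] that by (simp add: Z_def I_def)
  have Findep: "indep_vars (\<lambda>_. borel) (F t) ({..<lam} \<times> {..<n})" for t
  proof -
    have "indep_vars (\<lambda>k. PiM {Inr (t, k)} (\<lambda>_. borel)) (\<lambda>k \<omega>. restrict (\<lambda>k. Z k \<omega>) {Inr (t, k)}) ({..<lam} \<times> {..<n})"
      by (rule indep_vars_restrict[OF indep]) (auto simp: disjoint_family_on_def I_def)
    from indep_vars_compose2[OF this, of "\<lambda>k f. f (Inr (t, k))" "\<lambda>_. borel"] show ?thesis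
      by (simp add: Z_def F_def case_prod_unfold)
  qed
  note step_context = lam \<open>n \<ge> 1\<close> Fnormal Findep
  have Windep: "indep_vars (\<lambda>_. borel) (W j) UNIV" if j: "j < n" for j
  proof -
    \<comment> \<open>The blocks are disjoint: the initial entry of coordinate \<open>j\<close>,
      then all draws of one iteration each. \<open>Y\<close> computes the selected coordinate from
      its own block, so independence of the blocks passes to \<open>W j\<close>.\<close>
    define K :: "nat \<Rightarrow> (nat + nat \<times> nat \<times> nat) set" where
      "K = case_nat {Inl j} (\<lambda>t. Inr ` ({t} \<times> {..<lam} \<times> {..<n}))"
    define Y :: "nat \<Rightarrow> (nat + nat \<times> nat \<times> nat \<Rightarrow> real) \<Rightarrow> real" where
      "Y = case_nat (\<lambda>f. f (Inl j)) (\<lambda>t f. f (Inr (t, first_argmin lam (\<lambda>i. f (Inr (t, i, 0))), j)))"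
    have "indep_vars (\<lambda>k. PiM (K k) (\<lambda>_. borel)) (\<lambda>k \<omega>. restrict (\<lambda>i. Z i \<omega>) (K k)) UNIV"
      by (rule indep_vars_restrict[OF indep])
        (use j in \<open>auto simp: K_def I_def disjoint_family_on_def split: nat.splits\<close>)
    moreover have "Y k \<in> borel_measurable (PiM (K k) (\<lambda>_. borel))" for k
    proof (cases k)
      case (Suc t)
      show ?thesis unfolding Y_def Suc nat.case K_def
        using j \<open>n \<ge> 1\<close>
        by (intro measurable_selected[where X = "\<lambda>i f. f (Inr (t, i, 0))" and Y = "\<lambda>i f. f (Inr (t, i, j))"] lam
            measurable_component_singleton) auto
    qed (simp add: Y_def K_def)
    ultimately have "indep_vars (\<lambda>_. borel) (\<lambda>k \<omega>. Y k (restrict (\<lambda>i. Z i \<omega>) (K k))) UNIV"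
      by (rule indep_vars_compose2)
    moreover have "Y k (restrict (\<lambda>i. Z i \<omega>) (K k)) = W j k \<omega>" for k \<omega>
    proof (cases k)
      case (Suc t)
      have "first_argmin lam (\<lambda>i. restrict (\<lambda>i. Z i \<omega>) (K (Suc t)) (Inr (t, i, 0)))
          = first_argmin lam (\<lambda>i. F t (i, 0) \<omega>)"
        by (rule first_argmin_cong) (use \<open>n \<ge> 1\<close> in \<open>auto simp: K_def Z_def F_def\<close>)
      then show ?thesis
        using first_argmin(1)[OF lam] j by (simp add: Suc Y_def WSuc) (simp add: K_def Z_def F_def)
    qed (simp add: Y_def K_def W0 Z_def)
    ultimately show ?thesis by (simp cong: indep_vars_cong)
  qed
  have Wfourth: "fourth_moment (W j t)" "expectation (\<lambda>\<omega>. W j t \<omega> ^ 4) \<le> 3 * lam" if j: "j < n" for j t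
    using selected_step_fourth_moment[OF step_context j] std_normal_moments[OF P0normal[OF j]] lam
    by (cases t; simp add: W0 WSuc)+
  define m where "m j = (if j = 0 then mean_min_normal lam else 0)" for j :: nat
  define q where "q j = (if j = 0 then mean_sq_min_normal lam else 1)" for j :: nat
  have mean: "expectation (W j (Suc t)) = m j" and second: "expectation (\<lambda>\<omega>. (W j (Suc t) \<omega>)\<^sup>2) = q j"
    if j: "j < n" for j t
    using selected_step_moments_first[OF step_context] selected_step_moments_unselected[OF step_context, of j] j
    by (cases "j = 0"; simp add: WSuc m_def q_def)+
  define p where "p j t \<omega> = cumulation c (\<lambda>i. W j i \<omega>) t" for j t \<omega>
  define l where "l j = 2 * (1 - c) * (m j)\<^sup>2 / c + q j" for j
  note path = Windep Wfourth mean second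
  have p4: "fourth_moment (p j t)" if "j < n" for j t
    unfolding p_def using cumulation_fourth_moment[OF \<open>0 < c\<close> \<open>c \<le> 1\<close> path] that by blast
  have pAE: "AE \<omega> in M. (\<lambda>t. (\<Sum>s<t. (p j (Suc s) \<omega>)\<^sup>2) / real t) \<longlonglongrightarrow> l j" if "j < n" for j
    unfolding p_def l_def using cumulation_square_AE[OF \<open>0 < c\<close> \<open>c \<le> 1\<close> path] that by blast
  have pE: "(\<lambda>t. (\<Sum>s<t. expectation (\<lambda>\<omega>. (p j (Suc s) \<omega>)\<^sup>2)) / real t) \<longlonglongrightarrow> l j" if "j < n" for j
    unfolding p_def l_def using cumulation_square_expectation[OF \<open>0 < c\<close> \<open>c \<le> 1\<close> path] that by blast
  have state: "0 < \<sigma> t \<omega>" "ln (\<sigma> t \<omega> / \<sigma>0)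
      = c / (2 * d_\<sigma>) * ((\<Sum>j<n. \<Sum>s<t. (p j (Suc s) \<omega>)\<^sup>2) / n - t)" for t \<omega>
    using csa_state_cumulation[OF \<open>\<sigma>0 > 0\<close>, of n lam c d_\<sigma> X0 "\<lambda>j. P0 j \<omega>" "\<lambda>t i j. Xi t i j \<omega>" t]
    unfolding \<sigma>_def csa_sigma_def p_def W_def by auto
  have suml: "(\<Sum>j<n. l j) = 2 * (1 - c) * (mean_min_normal lam)\<^sup>2 / c + mean_sq_min_normal lam + (real n - 1)"
  proof -
    obtain n' where n': "n = Suc n'" using \<open>n \<ge> 1\<close> by (cases n) auto
    show ?thesis unfolding n' sum.lessThan_Suc_shift by (simp add: l_def m_def q_def)
  qed
  \<comment> \<open>The n - 1 unselected coordinates have limit 1, so after division by n and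
    subtraction of 1 only (2 * (1 - c) * m^2 / c + q - 1) / n remains, with the moments of the
    minimum.\<close>
  have L: "c / (2 * d_\<sigma>) * ((\<Sum>j<n. l j) / n - 1) = L"
    unfolding suml L_def using \<open>n \<ge> 1\<close> \<open>0 < c\<close> \<open>d_\<sigma> > 0\<close> by (simp add: field_simps)
  \<comment> \<open>Stated for arbitrary sums \<open>a\<close>, to serve both the realised squared
    paths and their expectations.\<close>
  have limit: "(\<lambda>t. c / (2 * d_\<sigma>) * ((\<Sum>j<n. a j t) / n - t) / real t) \<longlonglongrightarrow> L"
    if a: "\<And>j. j < n \<Longrightarrow> (\<lambda>t. a j t / real t) \<longlonglongrightarrow> l j" for a :: "nat \<Rightarrow> nat \<Rightarrow> real"
  proof -
    have "(\<lambda>t. c / (2 * d_\<sigma>) * ((\<Sum>j<n. a j t / real t) / n - 1)) \<longlonglongrightarrow> c / (2 * d_\<sigma>) * ((\<Sum>j<n. l j) / n - 1)"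
      by (intro tendsto_intros a) (use \<open>n \<ge> 1\<close> in auto)
    moreover have "\<forall>\<^sub>F t in sequentially. c / (2 * d_\<sigma>) * ((\<Sum>j<n. a j t / real t) / n - 1)
        = c / (2 * d_\<sigma>) * ((\<Sum>j<n. a j t) / n - t) / real t"
      using eventually_gt_at_top[of 0]
    proof eventually_elim
      case (elim t)
      then have "(\<Sum>j<n. a j t / real t) / n - 1 = ((\<Sum>j<n. a j t) / n - t) / t"
        by (simp add: diff_divide_distrib mult.commute flip: sum_divide_distrib)
      then show ?case by simp
    qed
    ultimately show ?thesis unfolding L by (rule Lim_transform_eventually)
  qed
  have AE_limit: "AE \<omega> in M. (\<lambda>t. ln (\<sigma> t \<omega> / \<sigma>0) / real t) \<longlonglongrightarrow> L"
  proof -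
    have "AE \<omega> in M. \<forall>j\<in>{..<n}. (\<lambda>t. (\<Sum>s<t. (p j (Suc s) \<omega>)\<^sup>2) / real t) \<longlonglongrightarrow> l j"
      by (rule AE_finite_allI) (auto intro: pAE)
    then show ?thesis unfolding state(2) by eventually_elim (rule limit, simp)
  qed
  have p2: "integrable M (\<lambda>\<omega>. (p j t \<omega>)\<^sup>2)" if "j < n" for j t
    by (rule fourth_moment_integrable_square[OF p4[OF that]])
  have S: "integrable M (\<lambda>\<omega>. \<Sum>j<n. \<Sum>s<t. (p j (Suc s) \<omega>)\<^sup>2)"
    "expectation (\<lambda>\<omega>. \<Sum>j<n. \<Sum>s<t. (p j (Suc s) \<omega>)\<^sup>2) = (\<Sum>j<n. \<Sum>s<t. expectation (\<lambda>\<omega>. (p j (Suc s) \<omega>)\<^sup>2))" for t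
  proof -
    have row: "integrable M (\<lambda>\<omega>. \<Sum>s<t. (p j (Suc s) \<omega>)\<^sup>2)" if "j \<in> {..<n}" for j
      using p2 that by (intro Bochner_Integration.integrable_sum) simp
    show "integrable M (\<lambda>\<omega>. \<Sum>j<n. \<Sum>s<t. (p j (Suc s) \<omega>)\<^sup>2)"
      by (rule Bochner_Integration.integrable_sum) (rule row)
    have "expectation (\<lambda>\<omega>. \<Sum>j<n. \<Sum>s<t. (p j (Suc s) \<omega>)\<^sup>2) = (\<Sum>j<n. expectation (\<lambda>\<omega>. \<Sum>s<t. (p j (Suc s) \<omega>)\<^sup>2))"
      by (rule Bochner_Integration.integral_sum) (rule row)
    also have "\<dots> = (\<Sum>j<n. \<Sum>s<t. expectation (\<lambda>\<omega>. (p j (Suc s) \<omega>)\<^sup>2))"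
      using p2 by (intro sum.cong Bochner_Integration.integral_sum refl) simp
    finally show "expectation (\<lambda>\<omega>. \<Sum>j<n. \<Sum>s<t. (p j (Suc s) \<omega>)\<^sup>2)
        = (\<Sum>j<n. \<Sum>s<t. expectation (\<lambda>\<omega>. (p j (Suc s) \<omega>)\<^sup>2))" .
  qed
  have integrable: "integrable M (\<lambda>\<omega>. ln (\<sigma> t \<omega> / \<sigma>0))" for t
    unfolding state(2) using S(1)[of t] by simp
  have E_limit: "(\<lambda>t. expectation (\<lambda>\<omega>. ln (\<sigma> t \<omega> / \<sigma>0)) / real t) \<longlonglongrightarrow> L"
  proof -
    have "expectation (\<lambda>\<omega>. ln (\<sigma> t \<omega> / \<sigma>0))
        = c / (2 * d_\<sigma>) * ((\<Sum>j<n. \<Sum>s<t. expectation (\<lambda>\<omega>. (p j (Suc s) \<omega>)\<^sup>2)) / n - t)" for t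
      unfolding state(2) using S[of t] by (simp add: prob_space)
    then show ?thesis using limit[OF pE] by (simp only:)
  qed
  \<comment> \<open>The first coordinates drawn in iteration 0 realise \<open>lam\<close>
    independent standard normals on \<open>M\<close>, as the inequalities for the two constants
    require.\<close>
  define G where "G = (\<lambda>i. F 0 (i, 0))"
  have Gnormal: "distributed M lborel (G i) std_normal_density" if "i < lam" for i
    using Fnormal[of i 0 0] that \<open>n \<ge> 1\<close> by (simp add: G_def)
  have Gindep: "indep_vars (\<lambda>_. borel) G {..<lam}"
    unfolding G_def by (rule first_coordinate_indep[OF step_context])
  have pos3: "L > 0" if "lam \<ge> 3"
  proof -
    have "0 < c * (mean_sq_min_normal lam - 1)"
      using mean_sq_min_normal_greater_1[OF lam Gnormal Gindep that] \<open>0 < c\<close> by simp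
    moreover have "0 \<le> 2 * (1 - c) * (mean_min_normal lam)\<^sup>2" using \<open>c \<le> 1\<close> by simp
    ultimately show ?thesis unfolding L_def using \<open>n \<ge> 1\<close> \<open>d_\<sigma> > 0\<close> by simp
  qed
  have pos2: "L > 0" if "lam = 2" "c < 1"
  proof -
    have "0 \<le> c * (mean_sq_min_normal lam - 1)"
      using mean_sq_min_normal_ge_1[OF lam Gnormal Gindep] \<open>0 < c\<close> by simp
    moreover have "0 < 2 * (1 - c) * (mean_min_normal lam)\<^sup>2"
      using mean_min_normal_2_nonzero[OF lam Gnormal Gindep that(1)] that(2) by simp
    ultimately show ?thesis unfolding L_def using \<open>n \<ge> 1\<close> \<open>d_\<sigma> > 0\<close> by simp
  qed
  have diverge: "AE \<omega> in M. filterlim (\<lambda>t. \<sigma> t \<omega>) at_top sequentially" if "L > 0"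
    using AE_limit
  proof eventually_elim
    case (elim \<omega>)
    \<comment> \<open>For t > 0 the step-size is \<sigma>0 times the exponential of t times the
      averaged logarithm, and that average tends to L > 0. At t = 0 the identity may fail because of
      division by 0, so it is used only eventually.\<close>
    have "filterlim (\<lambda>t. ln (\<sigma> t \<omega> / \<sigma>0) / real t * real t) at_top sequentially"
      by (rule filterlim_tendsto_pos_mult_at_top[OF elim that filterlim_real_sequentially])
    then have "filterlim (\<lambda>t. exp (ln (\<sigma> t \<omega> / \<sigma>0) / real t * real t)) at_top sequentially"
      by (rule filterlim_compose[OF exp_at_top])
    then have "filterlim (\<lambda>t. \<sigma>0 * exp (ln (\<sigma> t \<omega> / \<sigma>0) / real t * real t)) at_top sequentially"
      by (rule filterlim_tendsto_pos_mult_at_top[OF tendsto_const \<open>\<sigma>0 > 0\<close>])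
    moreover have "\<forall>\<^sub>F t in sequentially. \<sigma>0 * exp (ln (\<sigma> t \<omega> / \<sigma>0) / real t * real t) = \<sigma> t \<omega>"
      using eventually_gt_at_top[of 0]
      by eventually_elim (use state(1) \<open>\<sigma>0 > 0\<close> in simp)
    ultimately show ?case by (simp cong: filterlim_cong)
  qed
  show ?thesis
    using AE_limit integrable E_limit pos2 pos3 diverge \<open>lam \<ge> 2\<close> by (cases "lam = 2") auto
qed

end
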